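(* In the setting described in the context, if $G/Z(G)$ is $A_1^{\mathrm{ad}}(q)=\mathrm{PSL}_2(q)$ (so $G=\mathrm{SL}_2(q)$), then the centric linking system of $G/Z(G)$ (at the prime $2$) has a noninner rigid automorphism induced by a field automorphism of $G$.
   Context: Setting. $q_0$ is a prime with $q_0\equiv1\pmod 4$, $q=q_0^{2^l}$ with $l\ge0$, $q\equiv1\pmod 8$, and $G=\mathrm{SL}_2(q)$ is the group of Lie type of universal type $A_1^{\mathrm{un}}(q)$, with $T$ its subgroup of diagonal matrices. $N_G(T)$ contains a (nonabelian) Sylow $2$-subgroup of $G$; fix $S\in\mathrm{Syl}_2(N_G(T))\subseteq\mathrm{Syl}_2(G)$. The Sylow $2$-subgroup used for $G/Z(G)$ is $SZ(G)/Z(G)$. A field automorphism of $G$ is one induced by applying an automorphism $u\mapsto u^{q_0^a}$ (with $a\ge1$) of $\mathbb F_q$ to matrix entries. For a finite group $H$ with $R\in\mathrm{Syl}_2(H)$: $\mathcal F_R(H)$ is the category whose objects are the subgroups of $R$ and whose morphisms are the conjugation maps between them induced by elements of $H$. A $2$-subgroup $P$ of $H$ is $2$-centric if $Z(P)\in\mathrm{Syl}_2(C_H(P))$. The centric linking system $\mathcal L=\mathcal L_R^c(H)$ has as objects the subgroups $P\le R$ that are $2$-centric in $H$, with $\mathrm{Mor}_{\mathcal L}(P,Q)=\{g\in H:gPg^{-1}\le Q\}/O_{2'}(C_H(P))$; $\delta_{P,Q}(g)$ is the class of $g\in R$ (when $gPg^{-1}\le Q$), $\delta_P=\delta_{P,P}$,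 and $\pi:\mathcal L\to\mathcal F_R(H)$ sends the class of $g$ to conjugation by $g$. An automorphism of $\mathcal L$ is a self-equivalence $\alpha$ with $\alpha(\delta_P(P))=\delta_{\alpha(P)}(\alpha(P))$ for each object $P$ and $\alpha(\delta_{P,Q}(1))=\delta_{\alpha(P),\alpha(Q)}(1)$ for objects $P\le Q$. It is rigid if $\alpha_R\circ\delta_R=\delta_R$ as homomorphisms $R\to\mathrm{Aut}_{\mathcal L}(R)$, where $\alpha_R$ is the map induced by $\alpha$ on $\mathrm{Aut}_{\mathcal L}(R)$; it is inner if it is conjugation by some $\gamma\in\mathrm{Aut}_{\mathcal L}(R)$ (sending $P\mapsto\pi(\gamma)(P)$ and $\psi:P\to Q$ to $\gamma|_Q\circ\psi\circ(\gamma|_P)^{-1}$, where $\gamma|_P:P\to\pi(\gamma)(P)$ is the restriction of $\gamma$), and noninner otherwise. $\mathrm{Out}(\mathcal L)$ is $\mathrm{Aut}(\mathcal L)$ modulo inner automorphisms. $\kappa_H:\mathrm{Out}(H)\to\mathrm{Out}(\mathcal L)$ sends the class of $\alpha\in\mathrm{Aut}(H)$ with $\alpha(R)=R$ to the class of the automorphism $P\mapsto\alpha(P)$, $gO_{2'}(C_H(P))\mapsto\alpha(g)O_{2'}(C_H(\alpha(P)))$. An automorphism of the centric linking system of $H=G/Z(G)$ is induced by $\psi\in\mathrm{Aut}(G)$ if its class in $\mathrm{Out}(\mathcal L)$ is $\kappa_H([\psi'])$, where $\psi'$ is the automorphism of $G/Z(G)$ induced by $\psi$.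
   Formalization: The formal statement assumes l ≥ 1 instead of l ≥ 0: for l = 0 (e.g. q = q_0 = 17) the field F_q is prime, every field automorphism of G is the identity, and any automorphism of the linking system it induces is inner, so the claim fails. *)

theory Defs
  imports "HOL-Analysis.Analysis" "HOL-Algebra.Bij" "HOL-Algebra.Group_Action"
    "HOL-Algebra.Generated_Groups"
begin

section \<open>Finite groups\<close>

definition centralizer :: "('a, 'b) monoid_scheme \<Rightarrow> 'a set \<Rightarrow> 'a set" where
  "centralizer G P = {g \<in> carrier G. \<forall>x\<in>P. g \<otimes>\<^bsub>G\<^esub> x = x \<otimes>\<^bsub>G\<^esub> g}"

definition center :: "('a, 'b) monoid_scheme \<Rightarrow> 'a set" where
  "center G = centralizer G (carrier G)"

definition conj_set :: "('a, 'b) monoid_scheme \<Rightarrow> 'a \<Rightarrow> 'a set \<Rightarrow> 'a set" where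
  "conj_set G g P = (\<lambda>x. g \<otimes>\<^bsub>G\<^esub> x \<otimes>\<^bsub>G\<^esub> inv\<^bsub>G\<^esub> g) ` P"

definition Syl2 :: "('a, 'b) monoid_scheme \<Rightarrow> 'a set set" where
  "Syl2 G = {P. subgroup P G \<and> card P = 2 ^ multiplicity 2 (order G)}"

text \<open>The largest normal subgroup of odd order \<open>O\<^sub>2\<^sub>'(G)\<close> of a finite group:
  a product of normal subgroups of odd order again has odd order.\<close>

definition odd_core :: "('a, 'b) monoid_scheme \<Rightarrow> 'a set" where
  "odd_core G = generate G (\<Union>{N. normal N G \<and> odd (card N)})"

definition InnGroup :: "('a, 'b) monoid_scheme \<Rightarrow> ('a \<Rightarrow> 'a) set" where
  "InnGroup G = (\<lambda>h. \<lambda>x\<in>carrier G. h \<otimes>\<^bsub>G\<^esub> x \<otimes>\<^bsub>G\<^esub> inv\<^bsub>G\<^esub> h) ` carrier G"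

definition OutGroup :: "('a, 'b) monoid_scheme \<Rightarrow> ('a \<Rightarrow> 'a) set monoid" where
  "OutGroup G = AutoGroup G Mod InnGroup G"

text \<open>The automorphism of \<open>G Mod N\<close> induced by an automorphism of \<open>G\<close> preserving \<open>N\<close>.\<close>

definition quot_aut :: "('a, 'b) monoid_scheme \<Rightarrow> 'a set \<Rightarrow> ('a \<Rightarrow> 'a) \<Rightarrow> 'a set \<Rightarrow> 'a set" where
  "quot_aut G N \<psi> = (\<lambda>U\<in>carrier (G Mod N). \<psi> ` U)"


section \<open>Categories and self-equivalences\<close>

record ('o, 'm) cat =
  Obj :: "'o set"
  Arr :: "'m set"
  Dom :: "'m \<Rightarrow> 'o"
  Cod :: "'m \<Rightarrow> 'o"
  Cmp :: "'m \<Rightarrow> 'm \<Rightarrow> 'm" \<comment> \<open>\<open>Cmp C g f\<close> is \<open>g\<close> after \<open>f\<close>\<close>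
  Idn :: "'o \<Rightarrow> 'm"

definition Hom :: "('o, 'm, 'z) cat_scheme \<Rightarrow> 'o \<Rightarrow> 'o \<Rightarrow> 'm set" where
  "Hom C P Q = {f \<in> Arr C. Dom C f = P \<and> Cod C f = Q}"

definition inverse_arrows :: "('o, 'm, 'z) cat_scheme \<Rightarrow> 'm \<Rightarrow> 'm \<Rightarrow> bool" where
  "inverse_arrows C f g \<longleftrightarrow> f \<in> Arr C \<and> g \<in> Hom C (Cod C f) (Dom C f) \<and>
     Cmp C g f = Idn C (Dom C f) \<and> Cmp C f g = Idn C (Cod C f)"

definition arr_inv :: "('o, 'm, 'z) cat_scheme \<Rightarrow> 'm \<Rightarrow> 'm" where
  "arr_inv C f = (THE g. inverse_arrows C f g)"

definition Aut_obj :: "('o, 'm, 'z) cat_scheme \<Rightarrow> 'o \<Rightarrow> 'm set" where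
  "Aut_obj C P = {f \<in> Hom C P P. \<exists>g. inverse_arrows C f g}"

text \<open>Functors are extensional, so that equality of pairs is equality of functors.\<close>

type_synonym ('o, 'm) func = "('o \<Rightarrow> 'o) \<times> ('m \<Rightarrow> 'm)"

definition endofunctor :: "('o, 'm, 'z) cat_scheme \<Rightarrow> ('o, 'm) func \<Rightarrow> bool" where
  "endofunctor C F \<longleftrightarrow>
     fst F \<in> Obj C \<rightarrow>\<^sub>E Obj C \<and> snd F \<in> Arr C \<rightarrow>\<^sub>E Arr C \<and>
     (\<forall>f\<in>Arr C. Dom C (snd F f) = fst F (Dom C f) \<and> Cod C (snd F f) = fst F (Cod C f)) \<and>
     (\<forall>P\<in>Obj C. snd F (Idn C P) = Idn C (fst F P)) \<and>
     (\<forall>f\<in>Arr C. \<forall>g\<in>Arr C. Cod C f = Dom C g \<longrightarrow>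
        snd F (Cmp C g f) = Cmp C (snd F g) (snd F f))"

definition func_comp :: "('o, 'm, 'z) cat_scheme \<Rightarrow> ('o, 'm) func \<Rightarrow> ('o, 'm) func \<Rightarrow> ('o, 'm) func" where
  "func_comp C F E = (compose (Obj C) (fst F) (fst E), compose (Arr C) (snd F) (snd E))"

definition func_id :: "('o, 'm, 'z) cat_scheme \<Rightarrow> ('o, 'm) func" where
  "func_id C = (\<lambda>P\<in>Obj C. P, \<lambda>f\<in>Arr C. f)"

definition nat_iso :: "('o, 'm, 'z) cat_scheme \<Rightarrow> ('o, 'm) func \<Rightarrow> ('o, 'm) func \<Rightarrow> bool" where
  "nat_iso C F E \<longleftrightarrow> (\<exists>\<eta>.
     (\<forall>P\<in>Obj C. \<eta> P \<in> Hom C (fst F P) (fst E P) \<and> (\<exists>g. inverse_arrows C (\<eta> P) g)) \<and>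
     (\<forall>f\<in>Arr C. Cmp C (\<eta> (Cod C f)) (snd F f) = Cmp C (snd E f) (\<eta> (Dom C f))))"

definition self_equivalence :: "('o, 'm, 'z) cat_scheme \<Rightarrow> ('o, 'm) func \<Rightarrow> bool" where
  "self_equivalence C F \<longleftrightarrow> endofunctor C F \<and>
     (\<exists>E. endofunctor C E \<and> nat_iso C (func_comp C E F) (func_id C) \<and>
          nat_iso C (func_comp C F E) (func_id C))"


section \<open>The centric linking system at the prime 2\<close>

definition two_centric :: "('a, 'b) monoid_scheme \<Rightarrow> 'a set \<Rightarrow> bool" where
  "two_centric H P \<longleftrightarrow>
     center (H\<lparr>carrier := P\<rparr>) \<in> Syl2 (H\<lparr>carrier := centralizer H P\<rparr>)"

definition cent_core :: "('a, 'b) monoid_scheme \<Rightarrow> 'a set \<Rightarrow> 'a set" where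
  "cent_core H P = odd_core (H\<lparr>carrier := centralizer H P\<rparr>)"

definition transporter :: "('a, 'b) monoid_scheme \<Rightarrow> 'a set \<Rightarrow> 'a set \<Rightarrow> 'a set" where
  "transporter H P Q = {g \<in> carrier H. conj_set H g P \<subseteq> Q}"

text \<open>An arrow \<open>P \<rightarrow> Q\<close> is a triple \<open>(P, Q, U)\<close> with \<open>U\<close> a left coset \<open>g O\<^sub>2\<^sub>'(C\<^sub>H(P))\<close>.\<close>

type_synonym 'a link_arr = "'a set \<times> 'a set \<times> 'a set"

definition link_class :: "('a, 'b) monoid_scheme \<Rightarrow> 'a set \<Rightarrow> 'a set \<Rightarrow> 'a \<Rightarrow> 'a link_arr" where
  "link_class H P Q g = (P, Q, g <#\<^bsub>H\<^esub> cent_core H P)"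

text \<open>The composite of the classes of \<open>h\<close> and \<open>g\<close> is the class of \<open>h g\<close>. For 2-centric \<open>P\<close>, \<open>Q\<close>
  and \<open>g P g\<^sup>-\<^sup>1 \<le> Q\<close> this is the product of the cosets as sets, because then
  \<open>g\<^sup>-\<^sup>1 O\<^sub>2\<^sub>'(C\<^sub>H(Q)) g \<le> O\<^sub>2\<^sub>'(C\<^sub>H(P))\<close>.\<close>

definition linking_system ::
    "('a, 'b) monoid_scheme \<Rightarrow> 'a set \<Rightarrow> ('a set, 'a link_arr) cat" where
  "linking_system H R =
     (let Ob = {P. subgroup P H \<and> P \<subseteq> R \<and> two_centric H P} in
      \<lparr>Obj = Ob,
       Arr = (\<Union>P\<in>Ob. \<Union>Q\<in>Ob. link_class H P Q ` transporter H P Q),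
       Dom = (\<lambda>(P, Q, U). P),
       Cod = (\<lambda>(P, Q, U). Q),
       Cmp = (\<lambda>(Q', S, V) (P, Q, U). (P, S, V <#>\<^bsub>H\<^esub> U)),
       Idn = (\<lambda>P. link_class H P P \<one>\<^bsub>H\<^esub>)\<rparr>)"

definition link_delta :: "('a, 'b) monoid_scheme \<Rightarrow> 'a set \<Rightarrow> 'a set \<Rightarrow> 'a \<Rightarrow> 'a link_arr" where
  "link_delta H P Q = (\<lambda>g. link_class H P Q g)"

text \<open>The underlying map of \<open>\<pi>(\<gamma>)\<close>. The set below is a singleton, since elements of \<open>C\<^sub>H(P)\<close> act
  trivially on the source \<open>P\<close>.\<close>

definition link_pi :: "('a, 'b) monoid_scheme \<Rightarrow> 'a link_arr \<Rightarrow> 'a \<Rightarrow> 'a" where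
  "link_pi H = (\<lambda>(P, Q, U). the_elem
     ((\<lambda>g. \<lambda>x\<in>P. g \<otimes>\<^bsub>H\<^esub> x \<otimes>\<^bsub>H\<^esub> inv\<^bsub>H\<^esub> g) ` U))"

definition link_aut :: "('a, 'b) monoid_scheme \<Rightarrow> 'a set \<Rightarrow> ('a set, 'a link_arr) func \<Rightarrow> bool" where
  "link_aut H R \<alpha> \<longleftrightarrow> self_equivalence (linking_system H R) \<alpha> \<and>
     (\<forall>P\<in>Obj (linking_system H R).
        snd \<alpha> ` link_delta H P P ` P = link_delta H (fst \<alpha> P) (fst \<alpha> P) ` fst \<alpha> P) \<and>
     (\<forall>P\<in>Obj (linking_system H R). \<forall>Q\<in>Obj (linking_system H R). P \<subseteq> Q \<longrightarrow>
        snd \<alpha> (link_delta H P Q \<one>\<^bsub>H\<^esub>) = link_delta H (fst \<alpha> P) (fst \<alpha> Q) \<one>\<^bsub>H\<^esub>)"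

definition link_Aut ::
    "('a, 'b) monoid_scheme \<Rightarrow> 'a set \<Rightarrow> ('a set, 'a link_arr) func monoid" where
  "link_Aut H R =
     \<lparr>carrier = {\<alpha>. link_aut H R \<alpha>},
      mult = func_comp (linking_system H R),
      one = func_id (linking_system H R)\<rparr>"

definition rigid :: "('a, 'b) monoid_scheme \<Rightarrow> 'a set \<Rightarrow> ('a set, 'a link_arr) func \<Rightarrow> bool" where
  "rigid H R \<alpha> \<longleftrightarrow> (\<forall>g\<in>R. snd \<alpha> (link_delta H R R g) = link_delta H R R g)"

text \<open>The restriction \<open>\<gamma>|\<^sub>P : P \<rightarrow> \<pi>(\<gamma>)(P)\<close> of \<open>\<gamma> : R \<rightarrow> R\<close>, relative to the inclusions
  \<open>\<delta>\<^sub>P\<^sub>,\<^sub>R(1)\<close>.\<close>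

definition link_restrict ::
    "('a, 'b) monoid_scheme \<Rightarrow> 'a set \<Rightarrow> 'a link_arr \<Rightarrow> 'a set \<Rightarrow> 'a link_arr" where
  "link_restrict H R \<gamma> P = (let L = linking_system H R; P' = link_pi H \<gamma> ` P in
     THE \<rho>. \<rho> \<in> Hom L P P' \<and>
       Cmp L (link_delta H P' R \<one>\<^bsub>H\<^esub>) \<rho> = Cmp L \<gamma> (link_delta H P R \<one>\<^bsub>H\<^esub>))"

definition link_conj ::
    "('a, 'b) monoid_scheme \<Rightarrow> 'a set \<Rightarrow> 'a link_arr \<Rightarrow> ('a set, 'a link_arr) func" where
  "link_conj H R \<gamma> = (let L = linking_system H R in
     (\<lambda>P\<in>Obj L. link_pi H \<gamma> ` P,
      \<lambda>f\<in>Arr L. Cmp L (link_restrict H R \<gamma> (Cod L f))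
                  (Cmp L f (arr_inv L (link_restrict H R \<gamma> (Dom L f))))))"

definition link_Inn ::
    "('a, 'b) monoid_scheme \<Rightarrow> 'a set \<Rightarrow> ('a set, 'a link_arr) func set" where
  "link_Inn H R = link_conj H R ` Aut_obj (linking_system H R) R"

definition link_Out ::
    "('a, 'b) monoid_scheme \<Rightarrow> 'a set \<Rightarrow> ('a set, 'a link_arr) func set monoid" where
  "link_Out H R = link_Aut H R Mod link_Inn H R"

text \<open>On arrows, \<open>\<phi> ` (g O\<^sub>2\<^sub>'(C\<^sub>H(P))) = \<phi>(g) O\<^sub>2\<^sub>'(C\<^sub>H(\<phi>(P)))\<close>.\<close>

definition link_of_aut ::
    "('a, 'b) monoid_scheme \<Rightarrow> 'a set \<Rightarrow> ('a \<Rightarrow> 'a) \<Rightarrow> ('a set, 'a link_arr) func" where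
  "link_of_aut H R \<phi> = (let L = linking_system H R in
     (\<lambda>P\<in>Obj L. \<phi> ` P, \<lambda>f\<in>Arr L. case f of (P, Q, U) \<Rightarrow> (\<phi> ` P, \<phi> ` Q, \<phi> ` U)))"

text \<open>\<open>\<kappa>\<^sub>H : Out(H) \<rightarrow> Out(L)\<close>, via representatives stabilizing \<open>R\<close>; these exist by Sylow's theorem
  and all give the same class.\<close>

definition kappa ::
    "('a, 'b) monoid_scheme \<Rightarrow> 'a set \<Rightarrow> ('a \<Rightarrow> 'a) set \<Rightarrow> ('a set, 'a link_arr) func set" where
  "kappa H R = (\<lambda>c\<in>carrier (OutGroup H). the_elem
     ((\<lambda>\<phi>. link_Inn H R #>\<^bsub>link_Aut H R\<^esub> link_of_aut H R \<phi>) ` {\<phi>\<in>c. \<phi> ` R = R}))"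


section \<open>The special linear group of rank 1\<close>

definition SL2 :: "('a::field ^ 2 ^ 2) monoid" where
  "SL2 = \<lparr>carrier = {A. det A = 1}, mult = (**), one = mat 1\<rparr>"

definition SL2_diag :: "('a::field ^ 2 ^ 2) set" where
  "SL2_diag = {A \<in> carrier SL2. \<forall>i j. i \<noteq> j \<longrightarrow> A $ i $ j = 0}"

text \<open>For a prime \<open>q0\<close> equal to the characteristic; the exponent 0 is excluded, but all field
  automorphisms, including the identity, occur with a positive exponent.\<close>

definition SL2_field_auts :: "nat \<Rightarrow> ('a::field ^ 2 ^ 2 \<Rightarrow> 'a ^ 2 ^ 2) set" where
  "SL2_field_auts q0 = {\<lambda>A\<in>carrier SL2. map_matrix (\<lambda>u. u ^ (q0 ^ a)) A | a. a \<ge> 1}"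

text \<open>\<open>\<alpha>\<close>, an automorphism of the linking system of \<open>G/Z(G)\<close> at \<open>R\<close>, is induced by \<open>\<psi>\<close>.\<close>

definition induced_by ::
    "('a, 'b) monoid_scheme \<Rightarrow> 'a set set \<Rightarrow> ('a \<Rightarrow> 'a) \<Rightarrow> ('a set set, 'a set link_arr) func \<Rightarrow> bool" where
  "induced_by G R \<psi> \<alpha> \<longleftrightarrow> (let H = G Mod center G in
     link_Inn H R #>\<^bsub>link_Aut H R\<^esub> \<alpha> =
     kappa H R (InnGroup H #>\<^bsub>AutoGroup H\<^esub> quot_aut G (center G) \<psi>))"

end

theory Submission
  imports Defs "HOL-Algebra.Multiplicative_Group" "HOL-Number_Theory.Residues"
begin

text \<open>Let \<open>s\<^sup>2 = q\<close> and \<open>\<sigma>(u) = u\<^sup>s\<close>, and let \<open>2\<^sup>n\<close> be the 2-part of \<open>q - 1\<close>. Since \<open>2\<^sup>n\<^sup>-\<^sup>1\<close> is the 2-part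
  of \<open>s - 1\<close>, \<open>\<sigma>\<close> sends each \<open>u\<close> of order dividing \<open>2\<^sup>n\<close> to \<open>\<plusminus>u\<close>, and an element \<open>\<zeta>\<close> of order \<open>2\<^sup>n\<close> to \<open>-\<zeta>\<close>.
  So, after correction by a diagonal matrix, \<open>\<sigma>\<close> induces an automorphism \<open>\<phi>\<close> of \<open>PSL\<^sub>2(q)\<close> that fixes the
  dihedral group \<open>R\<close> pointwise. On the normalizers (isomorphic to \<open>S\<^sub>4\<close>) of representatives of the two
  classes of four-groups of \<open>R\<close>, however, \<open>\<phi>\<close> acts differently: an element of order 3 is fixed in
  the first but not in the second. An inner automorphism of the linking system that agrees with \<open>\<phi>\<close>
  is conjugation by some \<open>h\<close> that centralizes the first four-group \<open>V\<close> and the element of order 3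
  acting on it; then \<open>h \<in> C(V) = V\<close>, so \<open>h = 1\<close>, which contradicts the action on the second normalizer.\<close>

text \<open>Arrows of the linking system are only cosets of the core \<open>O_2'(C(P))\<close>, and
  inverses, restrictions and \<open>kappa\<close> are given by definite descriptions. The obstacle
  is to compute with representatives. Everything rests on describing the core of a 2-centric
  \<open>P\<close> by element orders, as the elements of odd order in \<open>C(P)\<close>:
  conjugation and automorphisms visibly respect this. Where \<open>P\<close> is a self-centralizing
  2-group the core is trivial, so arrows are group elements and an equality of functors becomes an
  equality in the group. Hence innerness is tested on four-groups, and one \<open>h\<close> must
  serve all of them. The sign of \<open>\<sigma>\<close> on \<open>\<zeta>\<close> comes from s = 1
  mod 4: then s + 1 contributes exactly one factor 2 to q - 1 = (s - 1)(s + 1). The diagonal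
  correction needs a square root of e / \<open>\<sigma> e\<close> = e^(1-s), where
  \<open>ad e\<close> lies in the Sylow subgroup; it exists because s - 1 is even. In the quotient
  by the center the sign is invisible on \<open>R\<close>, whose elements are diagonal or
  antidiagonal, but not on the elements of order 3: there it changes the off-diagonal entries and
  leaves the diagonal alone.\<close>

section \<open>Centric 2-subgroups\<close>

text \<open>The transfer restricted to \<open>Z\<close> is a power map with exponent prime to the
  order of \<open>Z\<close>, hence bijective on \<open>Z\<close>; its kernel is the complement. An
  element of order prime to that of \<open>Z\<close> has trivial image, so it lies in the kernel.
  Applied with \<open>Z\<close> = Z(P) inside C(P), this produces the core.\<close>

lemma (in group) central_hall_complement:
  assumes fin: "finite (carrier G)" and Z: "subgroup Z G"
    and cen: "\<And>z g. z \<in> Z \<Longrightarrow> g \<in> carrier G \<Longrightarrow> z \<otimes> g = g \<otimes> z"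
    and cop: "coprime (card Z) (card (rcosets Z))"
  obtains K where "K \<lhd> G" "card K = card (rcosets Z)"
    "\<And>x n. x \<in> carrier G \<Longrightarrow> coprime n (card Z) \<Longrightarrow> x [^] (n::nat) = \<one> \<Longrightarrow> x \<in> K"
proof -
  interpret Z: subgroup Z G by (rule Z)
  define ZZ where "ZZ = G\<lparr>carrier := Z\<rparr>"
  interpret ZZ: comm_group ZZ
  proof -
    have "group ZZ" unfolding ZZ_def by (rule subgroup.subgroup_is_group[OF Z is_group])
    then show "comm_group ZZ"
      by (rule group.group_comm_groupI) (auto simp: ZZ_def cen)
  qed
  have ZZs[simp]: "carrier ZZ = Z" "mult ZZ = mult G" "one ZZ = \<one>" by (auto simp: ZZ_def)
  define r where "r U = (SOME x. x \<in> U)" for U :: "'a set"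
  have rin: "r U \<in> U" if "U \<in> rcosets Z" for U
    unfolding r_def using Z.rcosets_non_empty[OF that] by (simp add: some_in_eq)
  have rc: "r U \<in> carrier G" if "U \<in> rcosets Z" for U
    using rin[OF that] Z.rcosets_carrier[OF is_group that] by auto
  have mv: "U #> g \<in> rcosets Z" if "U \<in> rcosets Z" "g \<in> carrier G" for U g
    using that by (auto simp: RCOSETS_def coset_mult_assoc Z.subset)
  have mv2: "U #> g #> h = U #> (g \<otimes> h)" if "U \<in> rcosets Z" "g \<in> carrier G" "h \<in> carrier G" for U g h
    using that Z.rcosets_carrier[OF is_group] by (simp add: coset_mult_assoc)
  \<comment> \<open>The discrepancy between the translated representative of \<open>U\<close> and
    the chosen representative of the coset \<open>U #> g\<close>. Both lie in the same right coset,
    so it belongs to \<open>Z\<close>. The cocycle identity \<open>fmult\<close> makes the product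
    over all cosets a homomorphism.\<close>
  define f where "f g U = r U \<otimes> g \<otimes> inv (r (U #> g))" for g U
  have fZ: "f g U \<in> Z" if "U \<in> rcosets Z" "g \<in> carrier G" for g U
  proof -
    have "r U \<otimes> g \<in> U #> g" using rin[OF that(1)] by (auto simp: r_coset_def)
    then show ?thesis unfolding f_def
      using diff_neutralizes[OF Z mv[OF that] _ rin[OF mv[OF that]]] by blast
  qed
  have fmult: "f (g \<otimes> h) U = f g U \<otimes> f h (U #> g)"
    if "U \<in> rcosets Z" "g \<in> carrier G" "h \<in> carrier G" for g h U
  proof -
    have "f g U \<otimes> f h (U #> g) = r U \<otimes> g \<otimes> (inv (r (U #> g)) \<otimes> r (U #> g)) \<otimes> h \<otimes> inv (r (U #> g #> h))"
      unfolding f_def using that rc[OF that(1)] rc[OF mv[OF that(1,2)]] rc[OF mv[OF mv[OF that(1,2)] that(3)]]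
      by (simp only: m_assoc inv_closed m_closed)
    also have "\<dots> = f (g \<otimes> h) U"
      unfolding f_def using that rc[OF that(1)] rc[OF mv[OF that(1,2)]] rc[OF mv[OF that(1) m_closed[OF that(2,3)]]]
      by (simp add: mv2 m_assoc)
    finally show ?thesis by simp
  qed
  have bij: "bij_betw (\<lambda>U. U #> g) (rcosets Z) (rcosets Z)" if g: "g \<in> carrier G" for g
    by (rule bij_betw_byWitness[where f' = "\<lambda>U. U #> inv g"])
      (use g in \<open>auto simp: mv mv2 r_inv l_inv coset_mult_one Z.rcosets_carrier[OF is_group]\<close>)
  \<comment> \<open>the transfer to \<open>Z\<close>; it restricts to \<open>z \<mapsto> z ^ [G : Z]\<close> on the central subgroup \<open>Z\<close>\<close>
  define V where "V g = finprod ZZ (f g) (rcosets Z)" for g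
  have Vhom: "V \<in> hom G ZZ"
  proof (rule homI)
    show "V g \<in> carrier ZZ" if "g \<in> carrier G" for g
      unfolding V_def using fZ that by (intro ZZ.finprod_closed) auto
    fix g h assume g: "g \<in> carrier G" and h: "h \<in> carrier G"
    have "V (g \<otimes> h) = finprod ZZ (\<lambda>U. f g U \<otimes>\<^bsub>ZZ\<^esub> f h (U #> g)) (rcosets Z)"
      unfolding V_def using fZ g h by (intro ZZ.finprod_cong') (auto simp: fmult mv)
    also have "\<dots> = V g \<otimes>\<^bsub>ZZ\<^esub> finprod ZZ (\<lambda>U. f h (U #> g)) (rcosets Z)"
      unfolding V_def using fZ g h mv by (intro ZZ.finprod_multf) auto
    also have "finprod ZZ (\<lambda>U. f h (U #> g)) (rcosets Z) = finprod ZZ (f h) ((\<lambda>U. U #> g) ` (rcosets Z))"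
      using fZ g h mv bij[OF g] by (intro ZZ.finprod_reindex[symmetric]) (auto simp: bij_betw_def)
    also have "\<dots> = V h" unfolding V_def using bij[OF g] by (simp add: bij_betw_def)
    finally show "V (g \<otimes> h) = V g \<otimes>\<^bsub>ZZ\<^esub> V h" .
  qed
  interpret V: group_hom G ZZ V
    by (simp add: group_hom_def group_hom_axioms_def Vhom is_group ZZ.is_group)
  have pow: "x [^]\<^bsub>ZZ\<^esub> n = x [^] n" for x and n :: nat
    unfolding ZZ_def by (simp add: nat_pow_def)
  have fz: "f z U = z" if "z \<in> Z" "U \<in> rcosets Z" for z U
  proof -
    have "U #> z = U" using that
      by (auto simp: RCOSETS_def coset_mult_assoc Z.subset)
        (metis Z coset_join2 coset_mult_assoc Z.mem_carrier Z.subset cen)+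
    then show ?thesis unfolding f_def using that rc[OF that(2)]
      by (simp add: cen[symmetric] m_assoc)
  qed
  have Vz: "V z = z [^] card (rcosets Z)" if "z \<in> Z" for z
  proof -
    have "V z = finprod ZZ (\<lambda>U. z) (rcosets Z)"
      unfolding V_def using that by (intro ZZ.finprod_cong') (auto simp: fz)
    then show ?thesis using that by (simp add: ZZ.finprod_const pow)
  qed
  have finZ: "finite Z" using finite_subset[OF Z.subset fin] .
  have zcop: "z = \<one>" if "z \<in> Z" "z [^] n = \<one>" "coprime n (card Z)" for z and n :: nat
  proof -
    have "ZZ.ord z dvd n" using that by (intro ZZ.pow_eq_id[THEN iffD1]) (auto simp: pow)
    moreover have "ZZ.ord z dvd card Z"
      using ZZ.ord_dvd_group_order[of z] that by (simp add: order_def)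
    ultimately have "ZZ.ord z = 1" using that(3)
      by (meson coprime_common_divisor_nat)
    then show ?thesis using ZZ.ord_eq_1[of z] that by simp
  qed
  have "inj_on V Z"
  proof (rule inj_onI)
    fix x y assume x: "x \<in> Z" and y: "y \<in> Z" and e: "V x = V y"
    have "V (x \<otimes> inv y) = \<one>"
      using x y e by (simp add: V.hom_mult Z.mem_carrier V.hom_inv)
        (metis V.hom_closed ZZs ZZ.r_inv V.hom_inv Z.mem_carrier V.hom_mult m_closed)
    moreover have xy: "x \<otimes> inv y \<in> Z" using x y by simp
    ultimately have "(x \<otimes> inv y) [^] card (rcosets Z) = \<one>" using Vz by metis
    then have "x \<otimes> inv y = \<one>" using zcop[OF xy] cop by (metis coprime_commute)
    then show "x = y" using inv_equality[of x "inv y"] x y Z.mem_carrier by simp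
  qed
  moreover have "V ` Z \<subseteq> Z" using V.hom_closed Z.mem_carrier by auto
  ultimately have "V ` Z = Z" using finZ by (metis endo_inj_surj)
  then have im: "V ` carrier G = carrier ZZ"
    using V.hom_closed image_mono[OF Z.subset, of V] by auto
  define K where "K = kernel G ZZ V"
  have Kn: "K \<lhd> G" unfolding K_def by (rule V.normal_kernel)
  have "(\<lambda>X. the_elem (V ` X)) \<in> iso (G Mod K) ZZ"
    unfolding K_def using im by (rule V.FactGroup_iso_set)
  then have "card (rcosets K) = card Z"
    using iso_same_order by (fastforce simp: order_def FactGroup_def)
  moreover have "card (rcosets K) * card K = card (rcosets Z) * card Z"
    using lagrange[OF Z] lagrange[OF normal_imp_subgroup[OF Kn]] by simp
  moreover have "card Z > 0" using finZ Z.one_closed card_gt_0_iff by blast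
  ultimately have "card K = card (rcosets Z)" by simp
  moreover have "x \<in> K" if x: "x \<in> carrier G" "coprime n (card Z)" "x [^] n = \<one>" for x and n :: nat
  proof -
    have "V x [^]\<^bsub>ZZ\<^esub> n = \<one>" using V.hom_nat_pow[of x n] x V.hom_one by simp
    then have "V x = \<one>" using zcop[of "V x" n] x V.hom_closed by (simp add: pow)
    then show ?thesis using x by (simp add: K_def kernel_def)
  qed
  ultimately show ?thesis using that Kn by blast
qed


lemma (in group) subgroup_centralizer:
  assumes "P \<subseteq> carrier G"
  shows "subgroup (centralizer G P) G"
proof (rule subgroupI)
  have "\<one> \<in> centralizer G P" using assms by (auto simp: centralizer_def)
  then show "centralizer G P \<noteq> {}" by auto
next
  fix a assume a: "a \<in> centralizer G P"
  then have ac: "a \<in> carrier G" by (simp add: centralizer_def)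
  have "inv a \<otimes> x = x \<otimes> inv a" if x: "x \<in> P" for x
  proof -
    have xc: "x \<in> carrier G" using x assms by auto
    have ax: "a \<otimes> x = x \<otimes> a" using a x by (simp add: centralizer_def)
    have "inv a \<otimes> x = inv a \<otimes> (x \<otimes> a) \<otimes> inv a" using ac xc by (simp add: m_assoc)
    also have "\<dots> = inv a \<otimes> (a \<otimes> x) \<otimes> inv a" by (simp only: ax)
    also have "\<dots> = x \<otimes> inv a" using ac xc by (simp add: m_assoc[symmetric])
    finally show ?thesis .
  qed
  then show "inv a \<in> centralizer G P" using ac by (simp add: centralizer_def)
next
  fix a b assume a: "a \<in> centralizer G P" and b: "b \<in> centralizer G P"
  have "a \<otimes> b \<otimes> x = x \<otimes> (a \<otimes> b)" if x: "x \<in> P" for x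
  proof -
    have c: "x \<in> carrier G" "a \<in> carrier G" "b \<in> carrier G"
      using x assms a b by (auto simp: centralizer_def)
    have "a \<otimes> x = x \<otimes> a" "b \<otimes> x = x \<otimes> b" using a b x by (auto simp: centralizer_def)
    then show ?thesis using c by (metis m_assoc)
  qed
  then show "a \<otimes> b \<in> centralizer G P" using a b by (simp add: centralizer_def)
qed (auto simp: centralizer_def)

text \<open>Z(P) is central in C(P), and being Sylow there it has odd index. Its normal complement
  has odd order and contains every element of odd order, so it is the largest normal subgroup of odd
  order. The description by element orders is the form in which the core is used from here
  on.\<close>

lemma (in group) cent_core_two_centric:
  assumes fin: "finite (carrier G)" and P: "subgroup P G" and tc: "two_centric G P"
  shows "cent_core G P = {x \<in> centralizer G P. \<exists>n::nat. odd n \<and> x [^] n = \<one>}"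
    and "subgroup (cent_core G P) G"
proof -
  define C where "C = G\<lparr>carrier := centralizer G P\<rparr>"
  define Z where "Z = center (G\<lparr>carrier := P\<rparr>)"
  have CG: "subgroup (centralizer G P) G"
    using subgroup_centralizer[OF subgroup.subset[OF P]] .
  interpret C: group C unfolding C_def using subgroup.subgroup_is_group[OF CG is_group] .
  have Cs[simp]: "carrier C = centralizer G P" "mult C = mult G" "one C = \<one>"
    by (auto simp: C_def)
  have pow: "x [^]\<^bsub>C\<^esub> n = x [^] n" for x and n :: nat
    unfolding C_def by (simp add: nat_pow_def)
  have finC: "finite (carrier C)" using finite_subset[OF subgroup.subset[OF CG] fin] by simp
  have sylZ: "Z \<in> Syl2 C" using tc by (simp add: two_centric_def C_def Z_def)
  then have Z: "subgroup Z C" and cardZ: "card Z = 2 ^ multiplicity 2 (order C)"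
    by (auto simp: Syl2_def)
  have pos: "order C > 0" using finC C.order_gt_0_iff_finite by simp
  have lag: "card (rcosets\<^bsub>C\<^esub> Z) * card Z = order C" using C.lagrange[OF Z] .
  have oddi: "odd (card (rcosets\<^bsub>C\<^esub> Z))"
  proof
    assume "even (card (rcosets\<^bsub>C\<^esub> Z))"
    then have "2 * card Z dvd order C" using lag by (metis dvd_refl mult_dvd_mono)
    then have "2 ^ Suc (multiplicity 2 (order C)) dvd order C" by (simp add: cardZ)
    from multiplicity_geI[OF _ _ this] show False using pos by simp
  qed
  have cop: "coprime n (card Z)" if "odd n" for n :: nat
    using that by (simp add: cardZ)
  obtain K where K: "K \<lhd> C" "card K = card (rcosets\<^bsub>C\<^esub> Z)"
    "\<And>x n. x \<in> carrier C \<Longrightarrow> coprime n (card Z) \<Longrightarrow> x [^]\<^bsub>C\<^esub> (n::nat) = \<one>\<^bsub>C\<^esub> \<Longrightarrow> x \<in> K"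
  proof (rule C.central_hall_complement[OF finC Z])
    show "z \<otimes>\<^bsub>C\<^esub> g = g \<otimes>\<^bsub>C\<^esub> z" if "z \<in> Z" "g \<in> carrier C" for z g
      using that by (auto simp: Z_def center_def centralizer_def)
    show "coprime (card Z) (card (rcosets\<^bsub>C\<^esub> Z))" using cop[OF oddi] by (simp add: coprime_commute)
  qed blast
  have Ks: "subgroup K C" by (rule normal_imp_subgroup[OF K(1)])
  have oddel: "\<exists>n::nat. odd n \<and> x [^] n = \<one>" if N: "subgroup N C" "odd (card N)" "x \<in> N" for N x
  proof -
    interpret N: group "C\<lparr>carrier := N\<rparr>" using subgroup.subgroup_is_group[OF N(1) C.is_group] .
    have "x [^]\<^bsub>C\<lparr>carrier := N\<rparr>\<^esub> order (C\<lparr>carrier := N\<rparr>) = \<one>\<^bsub>C\<lparr>carrier := N\<rparr>\<^esub>"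
      using N.pow_order_eq_1[of x] N(3) by simp
    then have "x [^] card N = \<one>" by (simp add: order_def nat_pow_def C_def)
    then show ?thesis using N(2) by blast
  qed
  have Kin: "x \<in> K" if "x \<in> centralizer G P" "odd n" "x [^] n = \<one>" for x and n :: nat
    using K(3)[of x n] cop that by (simp add: pow)
  have Keq: "K = {x \<in> centralizer G P. \<exists>n::nat. odd n \<and> x [^] n = \<one>}"
  proof
    show "K \<subseteq> {x \<in> centralizer G P. \<exists>n::nat. odd n \<and> x [^] n = \<one>}"
      using oddel[OF Ks] oddi K(2) subgroup.subset[OF Ks] by auto
    show "{x \<in> centralizer G P. \<exists>n::nat. odd n \<and> x [^] n = \<one>} \<subseteq> K"
      using Kin by blast
  qed
  have "odd_core C = K"
  proof
    show "K \<subseteq> odd_core C"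
      unfolding odd_core_def using K(1,2) oddi by (intro subsetI generate.incl UnionI[of K]) auto
    have "(\<Union>{N. N \<lhd> C \<and> odd (card N)}) \<subseteq> K"
    proof
      fix x assume "x \<in> \<Union>{N. N \<lhd> C \<and> odd (card N)}"
      then obtain N where N: "subgroup N C" "odd (card N)" "x \<in> N"
        using normal_imp_subgroup by blast
      then have "x \<in> centralizer G P" using subgroup.subset[OF N(1)] by auto
      then show "x \<in> K" using oddel[OF N] Kin by blast
    qed
    then show "odd_core C \<subseteq> K"
      unfolding odd_core_def using C.generate_subgroup_incl[OF _ Ks] by simp
  qed
  then have eq: "cent_core G P = K" by (simp add: cent_core_def C_def)
  show "cent_core G P = {x \<in> centralizer G P. \<exists>n::nat. odd n \<and> x [^] n = \<one>}"
    using eq Keq by simp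
  show "subgroup (cent_core G P) G"
    using eq Ks incl_subgroup[OF CG] by (simp add: C_def)
qed

text \<open>Here Z(P) = C(P) is a 2-group, so it is its own Sylow subgroup and has no nontrivial
  element of odd order. Cosets of the core are then singletons, and arrows out of \<open>P\<close>
  are elements of the group.\<close>

lemma (in group) self_centralizing_two_group:
  assumes fin: "finite (carrier G)" and P: "subgroup P G" and card: "card P = 2 ^ n"
    and cen: "centralizer G P \<subseteq> P"
  shows "two_centric G P" and "cent_core G P = {\<one>}"
proof -
  define C where "C = centralizer G P"
  have CG: "subgroup C G" unfolding C_def
    using subgroup_centralizer[OF subgroup.subset[OF P]] .
  have ctr: "center (G\<lparr>carrier := P\<rparr>) = C"
    using cen subgroup.subset[OF P] by (auto simp: center_def centralizer_def C_def)
  interpret P: group "G\<lparr>carrier := P\<rparr>" using subgroup.subgroup_is_group[OF P is_group] .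
  interpret C: group "G\<lparr>carrier := C\<rparr>" using subgroup.subgroup_is_group[OF CG is_group] .
  have "subgroup C (G\<lparr>carrier := P\<rparr>)"
    using subgroup_incl[OF CG P] cen C_def by simp
  then have "card C dvd 2 ^ n"
    using P.lagrange[of C] card by (simp add: order_def) (metis dvd_triv_right)
  then obtain m where m: "card C = 2 ^ m" using divides_primepow_nat two_is_prime_nat by blast
  show tc: "two_centric G P"
    unfolding two_centric_def ctr Syl2_def using C.subgroup_self m
    by (simp add: C_def[symmetric] order_def)
  show "cent_core G P = {\<one>}"
  proof -
    have "x = \<one>" if x: "x \<in> C" "odd k" "x [^] k = \<one>" for x and k :: nat
    proof -
      have xG: "x \<in> carrier G" using x subgroup.subset[OF CG] by auto
      have "x [^]\<^bsub>G\<lparr>carrier := C\<rparr>\<^esub> order (G\<lparr>carrier := C\<rparr>) = \<one>"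
        using C.pow_order_eq_1[of x] x by simp
      then have "x [^] (2 ^ m :: nat) = \<one>" by (simp add: order_def nat_pow_def m)
      then have "ord x dvd 2 ^ m" "ord x dvd k" using x xG pow_eq_id by auto
      moreover have "coprime (2 ^ m) k" using x(2) by simp
      ultimately have "ord x = 1" by (meson coprime_common_divisor_nat)
      then show ?thesis using xG ord_eq_1 by simp
    qed
    moreover have "\<one> [^] (1::nat) = \<one>" by simp
    moreover have "odd (1::nat)" by simp
    ultimately have "{x \<in> C. \<exists>n::nat. odd n \<and> x [^] n = \<one>} = {\<one>}"
      using subgroup.one_closed[OF CG] by blast
    then show ?thesis using cent_core_two_centric(1)[OF fin P tc] by (simp add: C_def)
  qed
qed


section \<open>The linking system of a finite group\<close>

text \<open>\<open>R\<close> is asked only to be 2-centric, that is, an object. For the image of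
  \<open>S\<close> this is obtained from a self-centralizing four-group inside it.\<close>

locale linking = group H for H (structure) +
  fixes R
  assumes fin: "finite (carrier H)" and R: "subgroup R H" and R_centric: "two_centric H R"
begin

abbreviation L where "L \<equiv> linking_system H R"
abbreviation core where "core P \<equiv> cent_core H P"

lemma Obj_iff: "P \<in> Obj L \<longleftrightarrow> subgroup P H \<and> P \<subseteq> R \<and> two_centric H P"
  by (simp add: linking_system_def Let_def)

lemma R_Obj: "R \<in> Obj L"
  using R R_centric by (simp add: Obj_iff)

lemma Obj_subset: "P \<in> Obj L \<Longrightarrow> P \<subseteq> carrier H"
  using subgroup.subset by (auto simp: Obj_iff)

lemma Obj_subgroup: "P \<in> Obj L \<Longrightarrow> subgroup P H"
  by (simp add: Obj_iff)

lemma Arr_iff: "f \<in> Arr L \<longleftrightarrow> (\<exists>P\<in>Obj L. \<exists>Q\<in>Obj L. \<exists>g\<in>transporter H P Q. f = (P, Q, g <# core P))"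
  by (auto simp: linking_system_def Let_def link_class_def)

lemma ArrI: "P \<in> Obj L \<Longrightarrow> Q \<in> Obj L \<Longrightarrow> g \<in> transporter H P Q \<Longrightarrow> (P, Q, g <# core P) \<in> Arr L"
  by (auto simp: Arr_iff)

lemma ArrE:
  assumes "f \<in> Arr L"
  obtains P Q g where "P \<in> Obj L" "Q \<in> Obj L" "g \<in> transporter H P Q" "f = (P, Q, g <# core P)"
  using assms by (auto simp: Arr_iff)

lemma L_simps [simp]:
  "Dom L (P, Q, U) = P" "Cod L (P, Q, U) = Q"
  "Cmp L (Q', S, V) (P, Q, U) = (P, S, V <#> U)"
  "Idn L P = (P, P, \<one> <# core P)"
  by (auto simp: linking_system_def Let_def link_class_def)

lemma transporter_carrier: "g \<in> transporter H P Q \<Longrightarrow> g \<in> carrier H"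
  by (simp add: transporter_def)

lemma transporterD:
  "g \<in> transporter H P Q \<Longrightarrow> x \<in> P \<Longrightarrow> g \<otimes> x \<otimes> inv g \<in> Q"
  by (auto simp: transporter_def conj_set_def)

lemma transporterI:
  "g \<in> carrier H \<Longrightarrow> (\<And>x. x \<in> P \<Longrightarrow> g \<otimes> x \<otimes> inv g \<in> Q) \<Longrightarrow> g \<in> transporter H P Q"
  by (auto simp: transporter_def conj_set_def)

lemma transporter_one: "P \<in> Obj L \<Longrightarrow> P \<subseteq> Q \<Longrightarrow> \<one> \<in> transporter H P Q"
  using Obj_subset by (intro transporterI) (auto simp: subset_iff)

lemma transporter_self: "P \<in> Obj L \<Longrightarrow> g \<in> P \<Longrightarrow> g \<in> transporter H P P"
  using Obj_subset[of P] Obj_subgroup[of P]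
  by (intro transporterI) (auto simp: subgroup.m_closed subgroup.m_inv_closed)

lemma transporter_mult:
  assumes P: "P \<subseteq> carrier H" and g: "g \<in> transporter H P Q" and h: "h \<in> transporter H Q S"
  shows "h \<otimes> g \<in> transporter H P S"
proof (rule transporterI)
  have c: "g \<in> carrier H" "h \<in> carrier H" using g h transporter_carrier by auto
  then show "h \<otimes> g \<in> carrier H" by simp
  fix x assume x: "x \<in> P"
  then have "h \<otimes> (g \<otimes> x \<otimes> inv g) \<otimes> inv h \<in> S" using g h transporterD by metis
  then show "h \<otimes> g \<otimes> x \<otimes> inv (h \<otimes> g) \<in> S"
    using c x P by (simp add: m_assoc inv_mult_group subsetD)
qed

lemma core_eq:
  "P \<in> Obj L \<Longrightarrow> core P = {x \<in> centralizer H P. \<exists>n::nat. odd n \<and> x [^] n = \<one>}"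
  using cent_core_two_centric(1)[OF fin] by (simp add: Obj_iff)

lemma core_subgroup: "P \<in> Obj L \<Longrightarrow> subgroup (core P) H"
  using cent_core_two_centric(2)[OF fin] by (simp add: Obj_iff)

lemma core_subset: "P \<in> Obj L \<Longrightarrow> core P \<subseteq> carrier H"
  using core_subgroup subgroup.subset by blast

lemma conj_nat_pow:
  assumes "g \<in> carrier H" "x \<in> carrier H"
  shows "(inv g \<otimes> x \<otimes> g) [^] (n::nat) = inv g \<otimes> x [^] n \<otimes> g"
proof (induction n)
  case (Suc n)
  have "(inv g \<otimes> x \<otimes> g) [^] Suc n = inv g \<otimes> x [^] n \<otimes> (g \<otimes> inv g) \<otimes> x \<otimes> g"
    using Suc assms by (simp only: nat_pow_Suc m_assoc m_closed inv_closed nat_pow_closed)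
  then show ?case using assms by (simp add: m_assoc)
qed (use assms in simp)

text \<open>If \<open>g\<close> carries \<open>P\<close> into \<open>Q\<close>, then conjugation by
  the inverse of \<open>g\<close> carries C(Q) into C(P) and preserves element orders. This is what
  makes the product of two cosets again a coset.\<close>

lemma core_conj:
  assumes P: "P \<in> Obj L" and Q: "Q \<in> Obj L" and g: "g \<in> transporter H P Q" and x: "x \<in> core Q"
  shows "inv g \<otimes> x \<otimes> g \<in> core P"
proof -
  have gc: "g \<in> carrier H" using g by (rule transporter_carrier)
  have xc: "x \<in> carrier H" using x core_subset[OF Q] by auto
  have "inv g \<otimes> x \<otimes> g \<otimes> y = y \<otimes> (inv g \<otimes> x \<otimes> g)" if y: "y \<in> P" for y
  proof -
    have yc: "y \<in> carrier H" using y Obj_subset[OF P] by auto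
    have "x \<otimes> (g \<otimes> y \<otimes> inv g) = (g \<otimes> y \<otimes> inv g) \<otimes> x"
      using x transporterD[OF g y] unfolding core_eq[OF Q] by (simp add: centralizer_def)
    then have "inv g \<otimes> (x \<otimes> (g \<otimes> y \<otimes> inv g)) \<otimes> g = inv g \<otimes> ((g \<otimes> y \<otimes> inv g) \<otimes> x) \<otimes> g"
      by simp
    moreover have "inv g \<otimes> (x \<otimes> (g \<otimes> y \<otimes> inv g)) \<otimes> g = inv g \<otimes> x \<otimes> g \<otimes> y"
      using gc xc yc by (simp add: m_assoc)
    moreover have "inv g \<otimes> ((g \<otimes> y \<otimes> inv g) \<otimes> x) \<otimes> g = y \<otimes> (inv g \<otimes> x \<otimes> g)"
      using gc xc yc by (simp add: m_assoc[symmetric])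
    ultimately show ?thesis by simp
  qed
  moreover obtain n :: nat where "odd n" "x [^] n = \<one>"
    using x unfolding core_eq[OF Q] by auto
  ultimately show ?thesis
    unfolding core_eq[OF P] using gc xc by (auto simp: centralizer_def conj_nat_pow)
qed

lemma core_absorb:
  assumes P: "P \<in> Obj L" and Q: "Q \<in> Obj L" and g: "g \<in> transporter H P Q"
  shows "core Q <#> (g <# core P) = g <# core P"
proof
  have gc: "g \<in> carrier H" using g by (rule transporter_carrier)
  interpret OP: subgroup "core P" H by (rule core_subgroup[OF P])
  interpret OQ: subgroup "core Q" H by (rule core_subgroup[OF Q])
  show "core Q <#> (g <# core P) \<subseteq> g <# core P"
  proof
    fix y assume "y \<in> core Q <#> (g <# core P)"
    then obtain x z where x: "x \<in> core Q" and z: "z \<in> core P" and y: "y = x \<otimes> (g \<otimes> z)"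
      by (auto simp: set_mult_def l_coset_def)
    have "y = g \<otimes> ((inv g \<otimes> x \<otimes> g) \<otimes> z)"
      unfolding y using gc x z by (simp add: m_assoc[symmetric])
    moreover have "(inv g \<otimes> x \<otimes> g) \<otimes> z \<in> core P"
      using core_conj[OF P Q g x] z by simp
    ultimately show "y \<in> g <# core P" by (auto simp: l_coset_def)
  qed
  show "g <# core P \<subseteq> core Q <#> (g <# core P)"
  proof
    fix y assume y: "y \<in> g <# core P"
    then have "y \<in> carrier H" using gc by (auto simp: l_coset_def)
    then have "y = \<one> \<otimes> y" by simp
    then show "y \<in> core Q <#> (g <# core P)" using y OQ.one_closed unfolding set_mult_def by blast
  qed
qed

text \<open>The product of cosets as sets is the coset of the product: by \<open>core_absorb\<close>
  the inner factor \<open>core Q\<close> is swallowed by \<open>core P\<close>. All later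
  computation in the category goes through this rule.\<close>

lemma class_mult:
  assumes P: "P \<in> Obj L" and Q: "Q \<in> Obj L" and g: "g \<in> transporter H P Q" and h: "h \<in> carrier H"
  shows "(h <# core Q) <#> (g <# core P) = (h \<otimes> g) <# core P"
proof -
  have gc: "g \<in> carrier H" using g by (rule transporter_carrier)
  have "(h <# core Q) <#> (g <# core P) = h <# (core Q <#> (g <# core P))"
    using gc h core_subset[OF P] core_subset[OF Q] by (simp add: setmult_lcos_assoc l_coset_subset_G)
  then show ?thesis
    using gc h core_subset[OF P] by (simp add: core_absorb[OF P Q g] lcos_m_assoc)
qed

lemma class_eq_iff:
  assumes P: "P \<in> Obj L" and g: "g \<in> carrier H" and h: "h \<in> carrier H"
  shows "g <# core P = h <# core P \<longleftrightarrow> inv g \<otimes> h \<in> core P"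
proof
  interpret OP: subgroup "core P" H by (rule core_subgroup[OF P])
  assume "g <# core P = h <# core P"
  moreover have "h \<otimes> \<one> \<in> h <# core P" using OP.one_closed unfolding l_coset_def by blast
  ultimately have "h \<in> g <# core P" using h by simp
  then show "inv g \<otimes> h \<in> core P" using g by (auto simp: l_coset_def m_assoc[symmetric])
next
  assume "inv g \<otimes> h \<in> core P"
  then have "h \<in> g <# core P"
    using subgroup.lcos_module_rev[OF core_subgroup[OF P] is_group g h] by simp
  then show "g <# core P = h <# core P"
    using l_repr_independence[OF _ g core_subgroup[OF P]] by simp
qed

lemma Hom_iff: "f \<in> Hom L P Q \<longleftrightarrow> P \<in> Obj L \<and> Q \<in> Obj L \<and> (\<exists>g\<in>transporter H P Q. f = (P, Q, g <# core P))"
  by (auto simp: Hom_def Arr_iff)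

lemma inverse_classes:
  assumes P: "P \<in> Obj L" and Q: "Q \<in> Obj L" and g: "g \<in> transporter H P Q" and h: "inv g \<in> transporter H Q P"
  shows "inverse_arrows L (P, Q, g <# core P) (Q, P, inv g <# core Q)"
  using assms transporter_carrier[OF g] ArrI[OF P Q g]
  by (auto simp: inverse_arrows_def Hom_iff class_mult)

text \<open>\<open>arr_inv\<close> is a definite description, so it can be evaluated only once every
  inverse of the class of \<open>g\<close> is known to be the class of \<open>inv g\<close>.\<close>

lemma inverse_arrows_unique:
  assumes P: "P \<in> Obj L" and Q: "Q \<in> Obj L" and g: "g \<in> transporter H P Q"
    and h: "inv g \<in> transporter H Q P" and f: "inverse_arrows L (P, Q, g <# core P) f"
  shows "f = (Q, P, inv g <# core Q)"
proof -
  obtain k where k: "k \<in> transporter H Q P" "f = (Q, P, k <# core Q)"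
    using f by (auto simp: inverse_arrows_def Hom_iff)
  have kc: "k \<in> carrier H" and gc: "g \<in> carrier H" using k g transporter_carrier by auto
  have "(g \<otimes> k) <# core Q = \<one> <# core Q"
    using f k class_mult[OF Q P k(1) gc] by (simp add: inverse_arrows_def)
  then have "inv (g \<otimes> k) \<otimes> \<one> \<in> core Q" using class_eq_iff[OF Q] kc gc by simp
  then have "inv k \<otimes> inv g \<in> core Q" using kc gc by (simp add: inv_mult_group)
  then show ?thesis using class_eq_iff[OF Q kc] gc k by simp
qed

lemma arr_inv_class:
  assumes "P \<in> Obj L" "Q \<in> Obj L" "g \<in> transporter H P Q" "inv g \<in> transporter H Q P"
  shows "arr_inv L (P, Q, g <# core P) = (Q, P, inv g <# core Q)"
  unfolding arr_inv_def using inverse_classes[OF assms] inverse_arrows_unique[OF assms] by (rule the_equality)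


subsection \<open>Functors induced by group automorphisms\<close>

context
  fixes \<phi> assumes \<phi>: "\<phi> \<in> auto H"
begin

lemma auto_closed: "x \<in> carrier H \<Longrightarrow> \<phi> x \<in> carrier H"
  using \<phi> by (auto simp: auto_def hom_def)

lemma auto_mult: "x \<in> carrier H \<Longrightarrow> y \<in> carrier H \<Longrightarrow> \<phi> (x \<otimes> y) = \<phi> x \<otimes> \<phi> y"
  using \<phi> by (auto simp: auto_def hom_def)

lemma auto_group_hom: "group_hom H H \<phi>"
  using \<phi> by (simp add: group_hom_def group_hom_axioms_def auto_def)

lemma auto_bij: "bij_betw \<phi> (carrier H) (carrier H)"
  using \<phi> by (simp add: auto_def Bij_def)

lemma auto_inj: "x \<in> carrier H \<Longrightarrow> y \<in> carrier H \<Longrightarrow> \<phi> x = \<phi> y \<longleftrightarrow> x = y"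
  using auto_bij by (auto simp: bij_betw_def inj_on_def)

lemma auto_one: "\<phi> \<one> = \<one>"
  using group_hom.hom_one[OF auto_group_hom] .

lemma auto_inv: "x \<in> carrier H \<Longrightarrow> \<phi> (inv x) = inv (\<phi> x)"
  using group_hom.hom_inv[OF auto_group_hom] .

lemma auto_nat_pow: "x \<in> carrier H \<Longrightarrow> \<phi> (x [^] (n::nat)) = \<phi> x [^] n"
  using group_hom.hom_nat_pow[OF auto_group_hom] .

lemma auto_inj_on: "X \<subseteq> carrier H \<Longrightarrow> inj_on \<phi> X"
  using auto_inj by (auto simp: inj_on_def subset_iff)

lemma auto_subgroup: "subgroup P H \<Longrightarrow> subgroup (\<phi> ` P) H"
  using group_hom.subgroup_img_is_subgroup[OF auto_group_hom] .

lemma auto_centralizer: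
  assumes "P \<subseteq> carrier H"
  shows "centralizer H (\<phi> ` P) = \<phi> ` centralizer H P"
proof
  show "\<phi> ` centralizer H P \<subseteq> centralizer H (\<phi> ` P)"
    using assms by (auto simp: centralizer_def auto_closed auto_mult[symmetric] subset_iff)
  show "centralizer H (\<phi> ` P) \<subseteq> \<phi> ` centralizer H P"
  proof
    fix y assume y: "y \<in> centralizer H (\<phi> ` P)"
    then obtain x where x: "x \<in> carrier H" "y = \<phi> x"
      using auto_bij by (auto simp: centralizer_def bij_betw_def)
    have "x \<in> centralizer H P"
      using y x assms by (auto simp: centralizer_def auto_mult[symmetric] subset_iff auto_inj)
    then show "y \<in> \<phi> ` centralizer H P" using x by simp
  qed
qed

lemma auto_two_centric:
  assumes P: "subgroup P H" and tc: "two_centric H P"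
  shows "two_centric H (\<phi> ` P)"
proof -
  have Pc: "P \<subseteq> carrier H" using subgroup.subset[OF P] .
  define C where "C = centralizer H P"
  have Cc: "subgroup C H" unfolding C_def using subgroup_centralizer[OF Pc] .
  have C': "centralizer H (\<phi> ` P) = \<phi> ` C" using auto_centralizer[OF Pc] C_def by simp
  have ctr: "center (H\<lparr>carrier := Q\<rparr>) = Q \<inter> centralizer H Q" if "Q \<subseteq> carrier H" for Q
    using that by (auto simp: center_def centralizer_def)
  have "\<phi> ` P \<subseteq> carrier H" using Pc auto_closed by auto
  then have Zeq: "center (H\<lparr>carrier := \<phi> ` P\<rparr>) = \<phi> ` (P \<inter> C)"
    using ctr C' inj_on_image_Int[OF auto_inj_on[of "carrier H"], of P C] Pc subgroup.subset[OF Cc]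
    by simp
  have Z: "subgroup (P \<inter> C) H" using subgroups_Inter_pair[OF P Cc] .
  have card: "card (P \<inter> C) = 2 ^ multiplicity 2 (card C)"
    using tc ctr[OF Pc] by (simp add: two_centric_def Syl2_def C_def order_def)
  have "card (\<phi> ` (P \<inter> C)) = card (P \<inter> C)" "card (\<phi> ` C) = card C"
    using Pc subgroup.subset[OF Cc] by (auto intro!: card_image auto_inj_on)
  moreover have "subgroup (\<phi> ` (P \<inter> C)) (H\<lparr>carrier := \<phi> ` C\<rparr>)"
    using auto_subgroup[OF Z] auto_subgroup[OF Cc] by (intro subgroup_incl) auto
  ultimately show ?thesis
    using card by (simp add: two_centric_def Zeq C' Syl2_def order_def)
qed

text \<open>By \<open>core_eq\<close> the core depends only on the centralizer and on element
  orders, and \<open>\<phi>\<close> preserves both.\<close>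

lemma auto_core:
  assumes P: "P \<in> Obj L" and P': "\<phi> ` P \<in> Obj L"
  shows "core (\<phi> ` P) = \<phi> ` core P"
proof -
  have "{x \<in> \<phi> ` centralizer H P. \<exists>n::nat. odd n \<and> x [^] n = \<one>} =
     \<phi> ` {x \<in> centralizer H P. \<exists>n::nat. odd n \<and> x [^] n = \<one>}"
  proof -
    have "\<phi> x [^] n = \<one> \<longleftrightarrow> x [^] n = \<one>" if "x \<in> centralizer H P" for x and n :: nat
      using that auto_inj[of "x [^] n" \<one>] by (simp add: centralizer_def auto_nat_pow auto_one)
    then show ?thesis by auto
  qed
  then show ?thesis
    unfolding core_eq[OF P] core_eq[OF P'] auto_centralizer[OF Obj_subset[OF P]] .
qed

lemma auto_l_coset:
  "g \<in> carrier H \<Longrightarrow> V \<subseteq> carrier H \<Longrightarrow> \<phi> ` (g <# V) = \<phi> g <# \<phi> ` V"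
  unfolding l_coset_def by (force simp: auto_mult subset_iff)

lemma auto_transporter:
  assumes P: "P \<subseteq> carrier H" and g: "g \<in> transporter H P Q"
  shows "\<phi> g \<in> transporter H (\<phi> ` P) (\<phi> ` Q)"
proof (rule transporterI)
  have gc: "g \<in> carrier H" using g by (rule transporter_carrier)
  then show "\<phi> g \<in> carrier H" by (rule auto_closed)
  fix y assume "y \<in> \<phi> ` P"
  then obtain x where x: "x \<in> P" "y = \<phi> x" by auto
  then have "\<phi> g \<otimes> y \<otimes> inv (\<phi> g) = \<phi> (g \<otimes> x \<otimes> inv g)"
    using gc P by (simp add: auto_mult auto_inv subset_iff)
  then show "\<phi> g \<otimes> y \<otimes> inv (\<phi> g) \<in> \<phi> ` Q" using transporterD[OF g x(1)] by simp
qed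

context
  assumes \<phi>R: "\<phi> ` R = R"
begin

lemma auto_Obj: "P \<in> Obj L \<Longrightarrow> \<phi> ` P \<in> Obj L"
  using \<phi>R auto_subgroup auto_two_centric by (fastforce simp: Obj_iff)

lemma auto_class:
  assumes "P \<in> Obj L" "g \<in> carrier H"
  shows "\<phi> ` (g <# core P) = \<phi> g <# core (\<phi> ` P)"
  using assms auto_Obj core_subset by (simp add: auto_l_coset auto_core)

lemma fst_link_of_aut: "P \<in> Obj L \<Longrightarrow> fst (link_of_aut H R \<phi>) P = \<phi> ` P"
  by (simp add: link_of_aut_def Let_def)

lemma snd_link_of_aut:
  assumes "P \<in> Obj L" "Q \<in> Obj L" "g \<in> transporter H P Q"
  shows "snd (link_of_aut H R \<phi>) (P, Q, g <# core P) = (\<phi> ` P, \<phi> ` Q, \<phi> g <# core (\<phi> ` P))"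
  using assms ArrI[OF assms] auto_class transporter_carrier by (simp add: link_of_aut_def Let_def)

lemma auto_Arr:
  assumes "P \<in> Obj L" "Q \<in> Obj L" "g \<in> transporter H P Q"
  shows "(\<phi> ` P, \<phi> ` Q, \<phi> g <# core (\<phi> ` P)) \<in> Arr L"
  using assms by (intro ArrI auto_Obj auto_transporter Obj_subset)

lemma link_of_aut_endofunctor: "endofunctor L (link_of_aut H R \<phi>)"
  unfolding endofunctor_def
proof (intro conjI ballI impI)
  let ?F = "link_of_aut H R \<phi>"
  show "fst ?F \<in> Obj L \<rightarrow>\<^sub>E Obj L"
    using auto_Obj by (auto simp: link_of_aut_def Let_def)
  show "snd ?F \<in> Arr L \<rightarrow>\<^sub>E Arr L"
  proof (rule PiE_I)
    fix f assume "f \<in> Arr L"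
    then show "snd ?F f \<in> Arr L" by (elim ArrE) (simp add: snd_link_of_aut auto_Arr)
  qed (simp add: link_of_aut_def Let_def)
  fix f assume f: "f \<in> Arr L"
  then show "Dom L (snd ?F f) = fst ?F (Dom L f)" "Cod L (snd ?F f) = fst ?F (Cod L f)"
    by (auto elim!: ArrE simp: snd_link_of_aut fst_link_of_aut)
  fix g assume "g \<in> Arr L" "Cod L f = Dom L g"
  with f show "snd ?F (Cmp L g f) = Cmp L (snd ?F g) (snd ?F f)"
    by (elim ArrE) (auto simp: snd_link_of_aut class_mult transporter_carrier auto_mult auto_Obj
        auto_closed auto_transporter Obj_subset transporter_mult)
next
  fix P assume "P \<in> Obj L"
  then show "snd (link_of_aut H R \<phi>) (Idn L P) = Idn L (fst (link_of_aut H R \<phi>) P)"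
    by (simp add: snd_link_of_aut transporter_one fst_link_of_aut auto_one)
qed

end
end

text \<open>Functoriality in the automorphism. On an inverse pair it yields an inverse functor; with
  an inner automorphism on the left it describes the cosets of \<open>link_Inn\<close>.\<close>

lemma link_of_aut_compose:
  assumes \<phi>: "\<phi> \<in> auto H" "\<phi> ` R = R" and \<psi>: "\<psi> \<in> auto H" "\<psi> ` R = R"
  shows "func_comp L (link_of_aut H R \<phi>) (link_of_aut H R \<psi>) = link_of_aut H R (compose (carrier H) \<phi> \<psi>)"
proof -
  let ?F = "link_of_aut H R \<phi>" and ?E = "link_of_aut H R \<psi>"
  define \<theta> where "\<theta> = compose (carrier H) \<phi> \<psi>"
  have im: "\<theta> ` X = \<phi> ` \<psi> ` X" if "X \<subseteq> carrier H" for X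
    using that by (auto simp: \<theta>_def compose_def image_iff subset_iff)
  have 1: "compose (Obj L) (fst ?F) (fst ?E) = fst (link_of_aut H R (\<theta>))"
    using auto_Obj[OF \<psi>] by (simp add: compose_def link_of_aut_def Let_def fun_eq_iff im[OF Obj_subset])
  have 2: "compose (Arr L) (snd ?F) (snd ?E) = snd (link_of_aut H R (\<theta>))"
  proof (rule extensionalityI[of _ "Arr L"])
    fix f assume f: "f \<in> Arr L"
    then obtain P Q g where f': "P \<in> Obj L" "Q \<in> Obj L" "g \<in> transporter H P Q" "f = (P, Q, g <# core P)"
      by (rule ArrE)
    have "g <# core P \<subseteq> carrier H"
      using core_subset[OF f'(1)] transporter_carrier[OF f'(3)] l_coset_subset_G by blast
    then have "snd (link_of_aut H R (\<theta>)) f = (\<phi> ` \<psi> ` P, \<phi> ` \<psi> ` Q, \<phi> ` \<psi> ` (g <# core P))"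
      using f f' Obj_subset by (simp add: link_of_aut_def Let_def im)
    also have "\<dots> = snd ?F (snd ?E f)"
      using f' auto_Arr[OF \<psi> f'(1-3)]
      by (simp add: snd_link_of_aut[OF \<psi>] auto_class[OF \<psi>] transporter_carrier link_of_aut_def[of _ _ \<phi>] Let_def)
    finally show "compose (Arr L) (snd ?F) (snd ?E) f = snd (link_of_aut H R (\<theta>)) f"
      using f by (simp add: compose_def)
  qed (auto simp: link_of_aut_def Let_def compose_def)
  show ?thesis unfolding func_comp_def 1 2 \<theta>_def by simp
qed

lemma link_of_aut_one: "link_of_aut H R (\<lambda>x\<in>carrier H. x) = func_id L"
proof -
  define i where "i = (\<lambda>x\<in>carrier H. x)"
  have im: "i ` X = X" if "X \<subseteq> carrier H" for X
    using that by (auto simp: i_def image_iff subset_iff)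
  have "(\<lambda>f\<in>Arr L. case f of (P, Q, U) \<Rightarrow> (i ` P, i ` Q, i ` U)) = (\<lambda>f\<in>Arr L. f)"
    by (rule restrict_ext, elim ArrE)
      (simp add: im Obj_subset core_subset l_coset_subset_G transporter_carrier)
  then have "link_of_aut H R i = func_id L"
    by (simp add: link_of_aut_def func_id_def Let_def fun_eq_iff im[OF Obj_subset])
  then show ?thesis by (simp add: i_def)
qed

lemma nat_iso_id: "nat_iso L (func_id L) (func_id L)"
  unfolding nat_iso_def
proof (rule exI[of _ "Idn L"], intro conjI ballI)
  fix P assume P: "P \<in> Obj L"
  then show "Idn L P \<in> Hom L (fst (func_id L) P) (fst (func_id L) P)"
    by (auto simp: func_id_def Hom_iff intro!: transporter_one)
  show "\<exists>g. inverse_arrows L (Idn L P) g"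
    using inverse_classes[OF P P, of \<one>] transporter_one[OF P] by auto
next
  fix f assume f: "f \<in> Arr L"
  then show "Cmp L (Idn L (Cod L f)) (snd (func_id L) f) = Cmp L (snd (func_id L) f) (Idn L (Dom L f))"
    by (auto elim!: ArrE simp: func_id_def class_mult transporter_carrier transporter_one)
qed

lemma auto_inverse:
  assumes \<phi>: "\<phi> \<in> auto H" "\<phi> ` R = R"
  obtains \<psi> where "\<psi> \<in> auto H" "\<psi> ` R = R"
    "compose (carrier H) \<psi> \<phi> = (\<lambda>x\<in>carrier H. x)" "compose (carrier H) \<phi> \<psi> = (\<lambda>x\<in>carrier H. x)"
proof -
  let ?\<psi> = "\<lambda>x\<in>carrier H. inv_into (carrier H) \<phi> x"
  have B: "\<phi> \<in> Bij (carrier H)" "\<phi> \<in> hom H H" using \<phi> by (auto simp: auto_def)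
  have 1: "?\<psi> \<in> auto H"
    using restrict_inv_into_Bij[OF B(1)] restrict_inv_into_hom[OF B(2,1)] by (simp add: auto_def)
  have Rc: "R \<subseteq> carrier H" using subgroup.subset[OF R] .
  have inj: "inj_on \<phi> (carrier H)" using B by (simp add: Bij_def bij_betw_def)
  have "?\<psi> ` R = inv_into (carrier H) \<phi> ` \<phi> ` R" using Rc \<phi>(2) by (auto simp: subset_iff)
  also have "\<dots> = R" using inj Rc by (simp add: inv_into_image_cancel)
  finally have 2: "?\<psi> ` R = R" .
  have 3: "compose (carrier H) ?\<psi> \<phi> = (\<lambda>x\<in>carrier H. x)" using Bij_compose_restrict_eq[OF B(1)] .
  have 4: "compose (carrier H) \<phi> ?\<psi> = (\<lambda>x\<in>carrier H. x)"
    using auto_bij[OF \<phi>(1)] by (auto simp: compose_def fun_eq_iff bij_betw_def f_inv_into_f)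
  show ?thesis by (rule that[OF 1 2 3 4])
qed

text \<open>The inverse group automorphism induces a strict inverse of the functor, so the natural
  isomorphisms required of a self-equivalence can be taken to be identities.\<close>

lemma link_of_aut_link_aut:
  assumes \<phi>: "\<phi> \<in> auto H" "\<phi> ` R = R"
  shows "link_aut H R (link_of_aut H R \<phi>)"
  unfolding link_aut_def
proof (intro conjI ballI impI)
  let ?F = "link_of_aut H R \<phi>"
  obtain \<psi> where \<psi>: "\<psi> \<in> auto H" "\<psi> ` R = R"
    "compose (carrier H) \<psi> \<phi> = (\<lambda>x\<in>carrier H. x)" "compose (carrier H) \<phi> \<psi> = (\<lambda>x\<in>carrier H. x)"
    using auto_inverse[OF \<phi>] .
  show "self_equivalence L ?F"
    unfolding self_equivalence_def
    using link_of_aut_endofunctor[OF \<phi>] link_of_aut_endofunctor[OF \<psi>(1,2)]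
      link_of_aut_compose[OF \<phi> \<psi>(1,2)] link_of_aut_compose[OF \<psi>(1,2) \<phi>] \<psi>(3,4) link_of_aut_one nat_iso_id
    by metis
next
  fix P assume P: "P \<in> Obj L"
  have "snd (link_of_aut H R \<phi>) (link_delta H P P g) = link_delta H (\<phi> ` P) (\<phi> ` P) (\<phi> g)" if "g \<in> P" for g
    using that snd_link_of_aut[OF \<phi> P P transporter_self[OF P]]
    by (simp add: link_delta_def link_class_def)
  then show "snd (link_of_aut H R \<phi>) ` link_delta H P P ` P =
      link_delta H (fst (link_of_aut H R \<phi>) P) (fst (link_of_aut H R \<phi>) P) ` fst (link_of_aut H R \<phi>) P"
    by (simp add: fst_link_of_aut[OF \<phi> P] image_image)
next
  fix P Q assume "P \<in> Obj L" "Q \<in> Obj L" "P \<subseteq> Q"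
  then show "snd (link_of_aut H R \<phi>) (link_delta H P Q \<one>) =
      link_delta H (fst (link_of_aut H R \<phi>) P) (fst (link_of_aut H R \<phi>) Q) \<one>"
    using snd_link_of_aut[OF \<phi>, of P Q \<one>] transporter_one
    by (simp add: link_delta_def link_class_def fst_link_of_aut[OF \<phi>] auto_one[OF \<phi>(1)])
qed


subsection \<open>Inner automorphisms of the linking system\<close>

definition inn where "inn h = (\<lambda>x\<in>carrier H. h \<otimes> x \<otimes> inv h)"

text \<open>The normalizer of \<open>R\<close> in \<open>H\<close>. Its elements represent the
  automorphisms of \<open>R\<close> in the linking system, by \<open>Aut_obj_R\<close>.\<close>

definition N where "N = {h \<in> carrier H. conj_set H h R = R}"

lemma R_subset: "R \<subseteq> carrier H"
  using subgroup.subset[OF R] .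

lemma inn_image: "P \<subseteq> carrier H \<Longrightarrow> inn h ` P = conj_set H h P"
  by (auto simp: inn_def conj_set_def subset_iff image_iff)

lemma inn_compose:
  "a \<in> carrier H \<Longrightarrow> b \<in> carrier H \<Longrightarrow> compose (carrier H) (inn a) (inn b) = inn (a \<otimes> b)"
  by (auto simp: inn_def compose_def fun_eq_iff m_assoc inv_mult_group)

lemma inn_one: "inn \<one> = (\<lambda>x\<in>carrier H. x)"
  by (auto simp: inn_def fun_eq_iff)

lemma inn_auto:
  assumes h: "h \<in> carrier H"
  shows "inn h \<in> auto H"
proof -
  have "inn h \<in> hom H H"
  proof (rule homI)
    fix x y assume xy: "x \<in> carrier H" "y \<in> carrier H"
    have "h \<otimes> x \<otimes> inv h \<otimes> (h \<otimes> y \<otimes> inv h) = h \<otimes> x \<otimes> (inv h \<otimes> h) \<otimes> y \<otimes> inv h"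
      using h xy by (simp only: m_assoc m_closed inv_closed)
    then show "inn h (x \<otimes> y) = inn h x \<otimes> inn h y"
      using h xy by (simp add: inn_def m_assoc)
  qed (use h in \<open>simp add: inn_def\<close>)
  moreover have "bij_betw (inn h) (carrier H) (carrier H)"
    by (rule bij_betw_byWitness[where f' = "inn (inv h)"])
      (use h in \<open>auto simp: inn_def m_assoc\<close>, (simp add: m_assoc[symmetric] h)+)
  moreover have "inn h \<in> extensional (carrier H)" by (simp add: inn_def)
  ultimately show ?thesis by (simp add: auto_def Bij_def)
qed

lemma N_carrier: "h \<in> N \<Longrightarrow> h \<in> carrier H"
  by (simp add: N_def)

lemma inn_R: "h \<in> N \<Longrightarrow> inn h ` R = R"
  by (simp add: N_def inn_image[OF R_subset])

lemma N_iff_inn: "h \<in> carrier H \<Longrightarrow> h \<in> N \<longleftrightarrow> inn h ` R = R"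
  by (simp add: N_def inn_image[OF R_subset])

lemma compose_image: "X \<subseteq> carrier H \<Longrightarrow> compose (carrier H) f g ` X = f ` g ` X"
  by (auto simp: compose_def image_iff subset_iff)

lemma N_mult: "a \<in> N \<Longrightarrow> b \<in> N \<Longrightarrow> a \<otimes> b \<in> N"
  using inn_compose[OF N_carrier N_carrier, of a b] compose_image[OF R_subset, of "inn a" "inn b"]
    N_iff_inn[OF m_closed[OF N_carrier N_carrier], of a b] inn_R by simp

lemma N_inv:
  assumes h: "h \<in> N"
  shows "inv h \<in> N"
proof -
  have hc: "h \<in> carrier H" using h by (rule N_carrier)
  have "inn (inv h) ` R = inn (inv h) ` inn h ` R" by (simp only: inn_R[OF h])
  also have "\<dots> = inn \<one> ` R"
    using inn_compose[of "inv h" h] compose_image[OF R_subset, of "inn (inv h)" "inn h"] hc by simp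
  also have "\<dots> = R" using R_subset by (auto simp: inn_one subset_iff image_iff)
  finally show ?thesis using N_iff_inn[of "inv h"] hc by simp
qed

lemma N_transporter: "h \<in> N \<Longrightarrow> h \<in> transporter H P (conj_set H h P)"
  by (simp add: transporter_def N_carrier)

lemma N_Obj: "h \<in> N \<Longrightarrow> P \<in> Obj L \<Longrightarrow> conj_set H h P \<in> Obj L"
  using auto_Obj[OF inn_auto inn_R] by (simp add: N_carrier inn_image[OF Obj_subset])

lemma N_inv_transporter:
  assumes "h \<in> N" "P \<in> Obj L"
  shows "inv h \<in> transporter H (conj_set H h P) P"
proof (rule transporterI)
  show "inv h \<in> carrier H" using assms N_carrier by simp
  fix y assume "y \<in> conj_set H h P"
  then obtain x where x: "x \<in> P" "y = h \<otimes> x \<otimes> inv h" by (auto simp: conj_set_def)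
  have "x \<in> carrier H" using x Obj_subset[OF assms(2)] by auto
  moreover have "h \<in> carrier H" using assms N_carrier by simp
  ultimately have "inv h \<otimes> y \<otimes> inv (inv h) = x"
    unfolding x by (simp add: m_assoc) (simp add: m_assoc[symmetric])
  then show "inv h \<otimes> y \<otimes> inv (inv h) \<in> P" using x by simp
qed

text \<open>An arrow from \<open>R\<close> to \<open>R\<close> only gives an inclusion of the
  conjugate of \<open>R\<close> in \<open>R\<close>; since \<open>R\<close> is finite, this is an
  equality.\<close>

lemma Aut_obj_R: "Aut_obj L R = link_class H R R ` N"
proof
  show "Aut_obj L R \<subseteq> link_class H R R ` N"
  proof
    fix f assume "f \<in> Aut_obj L R"
    then obtain g where g: "g \<in> transporter H R R" "f = (R, R, g <# core R)"
      by (auto simp: Aut_obj_def Hom_iff)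
    have gc: "g \<in> carrier H" using g transporter_carrier by simp
    have "inj_on (inn g) R" using auto_inj_on[OF inn_auto[OF gc] R_subset] .
    moreover have "inn g ` R \<subseteq> R" using g by (simp add: inn_image[OF R_subset] transporter_def)
    moreover have "finite R" using finite_subset[OF R_subset fin] .
    ultimately have "inn g ` R = R" by (simp add: endo_inj_surj)
    then show "f \<in> link_class H R R ` N" using g gc by (auto simp: link_class_def N_iff_inn)
  qed
  show "link_class H R R ` N \<subseteq> Aut_obj L R"
  proof
    fix f assume "f \<in> link_class H R R ` N"
    then obtain h where h: "h \<in> N" "f = (R, R, h <# core R)" by (auto simp: link_class_def)
    have "conj_set H h R = R" using h by (simp add: N_def)
    then have "h \<in> transporter H R R" "inv h \<in> transporter H R R"
      using N_transporter[OF h(1), of R] N_inv_transporter[OF h(1) R_Obj] by auto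
    then show "f \<in> Aut_obj L R"
      using inverse_classes[OF R_Obj R_Obj] h R_Obj by (auto simp: Aut_obj_def Hom_iff)
  qed
qed

text \<open>All representatives of the coset act alike on \<open>R\<close>, because the core
  centralizes \<open>R\<close>. So the set under \<open>the_elem\<close> is indeed a
  singleton.\<close>

lemma link_pi_class:
  assumes h: "h \<in> carrier H"
  shows "link_pi H (link_class H R R h) = (\<lambda>x\<in>R. h \<otimes> x \<otimes> inv h)"
proof -
  have "(\<lambda>x\<in>R. g \<otimes> x \<otimes> inv g) = (\<lambda>x\<in>R. h \<otimes> x \<otimes> inv h)" if g: "g \<in> h <# core R" for g
  proof (rule restrict_ext)
    fix x assume x: "x \<in> R"
    obtain u where u: "u \<in> core R" "g = h \<otimes> u" using g by (auto simp: l_coset_def)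
    have c: "u \<in> carrier H" "x \<in> carrier H" using u x core_subset[OF R_Obj] R_subset by auto
    have ux: "u \<otimes> x = x \<otimes> u" using u x unfolding core_eq[OF R_Obj] by (simp add: centralizer_def)
    have "g \<otimes> x \<otimes> inv g = h \<otimes> (u \<otimes> x) \<otimes> inv u \<otimes> inv h"
      unfolding u(2) using c h by (simp add: m_assoc inv_mult_group)
    also have "\<dots> = h \<otimes> x \<otimes> inv h" unfolding ux using c h by (simp add: m_assoc)
    finally show "g \<otimes> x \<otimes> inv g = h \<otimes> x \<otimes> inv h" .
  qed
  moreover have "h \<in> h <# core R"
  proof -
    have "h \<otimes> \<one> \<in> h <# core R"
      using subgroup.one_closed[OF core_subgroup[OF R_Obj]] unfolding l_coset_def by blast
    then show ?thesis using h by simp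
  qed
  ultimately have "(\<lambda>g. \<lambda>x\<in>R. g \<otimes> x \<otimes> inv g) ` (h <# core R) = {\<lambda>x\<in>R. h \<otimes> x \<otimes> inv h}"
    by blast
  then show ?thesis by (simp add: link_pi_def link_class_def)
qed

lemma link_pi_class_image:
  assumes "h \<in> carrier H" "P \<subseteq> R"
  shows "link_pi H (link_class H R R h) ` P = conj_set H h P"
  using assms(2) by (auto simp: link_pi_class[OF assms(1)] conj_set_def subset_iff image_iff)

text \<open>Composing with an inclusion keeps the coset and changes only the target. Hence the
  equation in the definite description already determines the coset of the restriction.\<close>

lemma link_restrict_class:
  assumes h: "h \<in> N" and P: "P \<in> Obj L"
  shows "link_restrict H R (link_class H R R h) P = (P, conj_set H h P, h <# core P)"
proof -
  let ?P = "conj_set H h P"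
  have P': "?P \<in> Obj L" using N_Obj[OF h P] .
  have hc: "h \<in> carrier H" using h N_carrier by simp
  have PR: "P \<subseteq> R" "?P \<subseteq> R" using P P' by (auto simp: Obj_iff)
  have "(h <# core R) <#> (\<one> <# core P) = h <# core P"
    using class_mult[OF P R_Obj transporter_one[OF P PR(1)] hc] hc by simp
  then have rhs: "Cmp L (link_class H R R h) (link_delta H P R \<one>) = (P, R, h <# core P)"
    by (simp add: link_class_def link_delta_def)
  have lhs: "Cmp L (link_delta H ?P R \<one>) (P, ?P, g <# core P) = (P, R, g <# core P)"
    if "g \<in> transporter H P ?P" for g
    using class_mult[OF P P' that one_closed] transporter_carrier[OF that]
    by (simp add: link_class_def link_delta_def)
  have "(THE \<rho>. \<rho> \<in> Hom L P ?P \<and> Cmp L (link_delta H ?P R \<one>) \<rho> = Cmp L (link_class H R R h) (link_delta H P R \<one>))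
      = (P, ?P, h <# core P)"
  proof (rule the_equality)
    show "(P, ?P, h <# core P) \<in> Hom L P ?P \<and>
      Cmp L (link_delta H ?P R \<one>) (P, ?P, h <# core P) = Cmp L (link_class H R R h) (link_delta H P R \<one>)"
      using P P' N_transporter[OF h] lhs[OF N_transporter[OF h]] rhs unfolding Hom_iff by metis
    fix \<rho> assume \<rho>: "\<rho> \<in> Hom L P ?P \<and>
      Cmp L (link_delta H ?P R \<one>) \<rho> = Cmp L (link_class H R R h) (link_delta H P R \<one>)"
    then obtain g where g: "g \<in> transporter H P ?P" "\<rho> = (P, ?P, g <# core P)"
      unfolding Hom_iff by blast
    then show "\<rho> = (P, ?P, h <# core P)" using \<rho> lhs[OF g(1)] rhs by simp
  qed
  then show ?thesis
    by (simp add: link_restrict_def Let_def link_pi_class_image[OF hc PR(1)])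
qed

text \<open>With restrictions and inverses evaluated, conjugation by the class of \<open>h\<close>
  sends the class of \<open>g\<close> to that of h g h^-1. Categorical inner automorphisms are thus
  exactly the functors induced by conjugation with elements of \<open>N\<close>.\<close>

lemma link_conj_class:
  assumes h: "h \<in> N"
  shows "link_conj H R (link_class H R R h) = link_of_aut H R (inn h)"
proof -
  have hc: "h \<in> carrier H" using h N_carrier by simp
  let ?\<gamma> = "link_class H R R h"
  have 1: "(\<lambda>P\<in>Obj L. link_pi H ?\<gamma> ` P) = fst (link_of_aut H R (inn h))"
    by (auto simp: link_of_aut_def Let_def fun_eq_iff inn_image[OF Obj_subset] link_pi_class_image[OF hc] Obj_iff)
  have 2: "(\<lambda>f\<in>Arr L. Cmp L (link_restrict H R ?\<gamma> (Cod L f))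
                  (Cmp L f (arr_inv L (link_restrict H R ?\<gamma> (Dom L f))))) = snd (link_of_aut H R (inn h))"
  proof (rule extensionalityI[of _ "Arr L"])
    fix f assume f: "f \<in> Arr L"
    then obtain P Q g where f': "P \<in> Obj L" "Q \<in> Obj L" "g \<in> transporter H P Q" "f = (P, Q, g <# core P)"
      by (rule ArrE)
    let ?P = "conj_set H h P" and ?Q = "conj_set H h Q"
    have P': "?P \<in> Obj L" "?Q \<in> Obj L" using N_Obj[OF h] f' by auto
    have gc: "g \<in> carrier H" using f' transporter_carrier by simp
    have t: "inv h \<in> transporter H ?P P" using N_inv_transporter[OF h f'(1)] .
    have gh: "g \<otimes> inv h \<in> transporter H ?P Q"
      using transporter_mult[OF Obj_subset[OF P'(1)] t f'(3)] .
    have "(g <# core P) <#> (inv h <# core ?P) = (g \<otimes> inv h) <# core ?P"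
      using class_mult[OF P'(1) f'(1) t gc] .
    moreover have "(h <# core Q) <#> ((g \<otimes> inv h) <# core ?P) = (h \<otimes> (g \<otimes> inv h)) <# core ?P"
      using class_mult[OF P'(1) f'(2) gh hc] .
    ultimately have "Cmp L (link_restrict H R ?\<gamma> (Cod L f)) (Cmp L f (arr_inv L (link_restrict H R ?\<gamma> (Dom L f))))
        = (?P, ?Q, (h \<otimes> g \<otimes> inv h) <# core ?P)"
      using f' P' h hc gc t arr_inv_class[OF f'(1) P'(1) N_transporter[OF h] t]
      by (simp add: link_restrict_class m_assoc)
    also have "\<dots> = snd (link_of_aut H R (inn h)) f"
      using snd_link_of_aut[OF inn_auto[OF hc] inn_R[OF h] f'(1-3)] f' gc
      by (simp add: inn_image[OF Obj_subset]) (simp add: inn_def)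
    finally show "(\<lambda>f\<in>Arr L. Cmp L (link_restrict H R ?\<gamma> (Cod L f))
        (Cmp L f (arr_inv L (link_restrict H R ?\<gamma> (Dom L f))))) f = snd (link_of_aut H R (inn h)) f"
      using f by simp
  qed (auto simp: link_of_aut_def Let_def)
  show ?thesis unfolding link_conj_def Let_def 1 2 by simp
qed

lemma link_Inn_eq: "link_Inn H R = link_of_aut H R ` inn ` N"
  unfolding link_Inn_def Aut_obj_R image_image
  by (rule image_cong[OF refl]) (rule link_conj_class)

lemma link_Inn_coset:
  assumes \<phi>: "\<phi> \<in> auto H" "\<phi> ` R = R"
  shows "link_Inn H R #>\<^bsub>link_Aut H R\<^esub> link_of_aut H R \<phi> =
    (\<lambda>m. link_of_aut H R (compose (carrier H) (inn m) \<phi>)) ` N"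
  by (auto simp: r_coset_def link_Inn_eq link_Aut_def N_carrier
      link_of_aut_compose[OF inn_auto inn_R \<phi>])

text \<open>Right translation by \<open>n\<close> permutes \<open>N\<close>, so the additional inner
  factor only reindexes the coset. This gives the independence of representatives needed for
  \<open>kappa\<close>.\<close>

lemma link_Inn_coset_inn:
  assumes \<phi>: "\<phi> \<in> auto H" "\<phi> ` R = R" and n: "n \<in> N"
  shows "link_Inn H R #>\<^bsub>link_Aut H R\<^esub> link_of_aut H R (compose (carrier H) (inn n) \<phi>) =
    link_Inn H R #>\<^bsub>link_Aut H R\<^esub> link_of_aut H R \<phi>"
proof -
  have nc: "n \<in> carrier H" using n N_carrier by simp
  have c: "compose (carrier H) (inn n) \<phi> \<in> auto H"
    using subgroup.m_closed[OF subgroup_auto inn_auto[OF nc] \<phi>(1)] inn_auto[OF nc] \<phi>(1)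
    by (simp add: BijGroup_def auto_def)
  have cR: "compose (carrier H) (inn n) \<phi> ` R = R"
    by (simp add: compose_image[OF R_subset] \<phi> inn_R[OF n])
  have "compose (carrier H) (inn m) (compose (carrier H) (inn n) \<phi>) = compose (carrier H) (inn (m \<otimes> n)) \<phi>"
    if "m \<in> N" for m
    using compose_assoc[of \<phi> "carrier H" "carrier H" "inn m" "inn n"] auto_closed[OF \<phi>(1)]
    by (simp add: inn_compose[OF N_carrier[OF that] nc] Pi_def)
  moreover have mult: "(\<lambda>m. m \<otimes> n) ` N = N"
  proof
    show "(\<lambda>m. m \<otimes> n) ` N \<subseteq> N" using n N_mult by auto
    show "N \<subseteq> (\<lambda>m. m \<otimes> n) ` N"
    proof
      fix m assume m: "m \<in> N"
      then have "m = (m \<otimes> inv n) \<otimes> n" using nc N_carrier by (simp add: m_assoc)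
      then show "m \<in> (\<lambda>m. m \<otimes> n) ` N" using m n N_mult N_inv by blast
    qed
  qed
  ultimately have "(\<lambda>m. link_of_aut H R (compose (carrier H) (inn m) (compose (carrier H) (inn n) \<phi>))) ` N
      = (\<lambda>m. link_of_aut H R (compose (carrier H) (inn m) \<phi>)) ` (\<lambda>m. m \<otimes> n) ` N"
    unfolding image_image by (intro image_cong refl) simp
  then show ?thesis
    unfolding link_Inn_coset[OF \<phi>] link_Inn_coset[OF c cR] mult by simp
qed

section \<open>Evaluation of \<open>kappa\<close> and the consequence of innerness\<close>

lemma InnGroup_eq: "InnGroup H = inn ` carrier H"
  by (simp add: InnGroup_def inn_def[abs_def])

lemma InnGroup_coset:
  assumes \<psi>: "\<psi> \<in> auto H"
  shows "InnGroup H #>\<^bsub>AutoGroup H\<^esub> \<psi> = (\<lambda>h. compose (carrier H) (inn h) \<psi>) ` carrier H"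
proof -
  have "inn h \<otimes>\<^bsub>AutoGroup H\<^esub> \<psi> = compose (carrier H) (inn h) \<psi>" if "h \<in> carrier H" for h
    using inn_auto[OF that] \<psi> by (simp add: AutoGroup_def BijGroup_def auto_def)
  then show ?thesis by (auto simp: r_coset_def InnGroup_eq)
qed

text \<open>Two representatives of one outer class that both stabilize \<open>R\<close> differ by
  conjugation with an element of \<open>N\<close>, so they give the same coset of
  \<open>link_Inn\<close>. The value of \<open>kappa\<close> can therefore be read off from any
  convenient \<open>\<phi>\<close>.\<close>

lemma kappa_eq:
  assumes \<psi>: "\<psi> \<in> auto H" and h: "h \<in> carrier H"
    and \<phi>: "\<phi> = compose (carrier H) (inn h) \<psi>" "\<phi> ` R = R"
  shows "\<phi> \<in> auto H"
    and "kappa H R (InnGroup H #>\<^bsub>AutoGroup H\<^esub> \<psi>) = link_Inn H R #>\<^bsub>link_Aut H R\<^esub> link_of_aut H R \<phi>"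
proof -
  let ?c = "InnGroup H #>\<^bsub>AutoGroup H\<^esub> \<psi>"
  show \<phi>a: "\<phi> \<in> auto H"
    using subgroup.m_closed[OF subgroup_auto inn_auto[OF h] \<psi>] inn_auto[OF h] \<psi>
    by (simp add: BijGroup_def auto_def \<phi>)
  have "?c \<in> carrier (OutGroup H)"
    using \<psi> by (auto simp: OutGroup_def FactGroup_def RCOSETS_def AutoGroup_def)
  moreover have "(\<lambda>\<phi>. link_Inn H R #>\<^bsub>link_Aut H R\<^esub> link_of_aut H R \<phi>) ` {\<phi> \<in> ?c. \<phi> ` R = R} =
      {link_Inn H R #>\<^bsub>link_Aut H R\<^esub> link_of_aut H R \<phi>}"
  proof -
    have "link_Inn H R #>\<^bsub>link_Aut H R\<^esub> link_of_aut H R \<theta> = link_Inn H R #>\<^bsub>link_Aut H R\<^esub> link_of_aut H R \<phi>"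
      if \<theta>': "\<theta> \<in> ?c" "\<theta> ` R = R" for \<theta>
    proof -
      obtain k where k: "k \<in> carrier H" "\<theta> = compose (carrier H) (inn k) \<psi>"
        using \<theta>' InnGroup_coset[OF \<psi>] by auto
      have "compose (carrier H) (inn (k \<otimes> inv h)) \<phi> = compose (carrier H) (inn (k \<otimes> inv h \<otimes> h)) \<psi>"
        using compose_assoc[of \<psi> "carrier H" "carrier H" "inn (k \<otimes> inv h)" "inn h"] auto_closed[OF \<psi>] k h
        by (simp add: \<phi> inn_compose Pi_def)
      then have \<theta>: "\<theta> = compose (carrier H) (inn (k \<otimes> inv h)) \<phi>" using k h by (simp add: m_assoc)
      then have "inn (k \<otimes> inv h) ` R = R"
        using \<theta>'(2) \<phi>(2) by (simp add: compose_image[OF R_subset])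
      then have "k \<otimes> inv h \<in> N" using k h by (simp add: N_iff_inn)
      then show ?thesis using link_Inn_coset_inn[OF \<phi>a \<phi>(2)] \<theta> by simp
    qed
    moreover have "\<phi> \<in> ?c" using InnGroup_coset[OF \<psi>] h \<phi> by auto
    ultimately show ?thesis using \<phi>(2) by blast
  qed
  ultimately show "kappa H R ?c = link_Inn H R #>\<^bsub>link_Aut H R\<^esub> link_of_aut H R \<phi>"
    by (simp add: kappa_def)
qed

lemma rigid_link_of_aut:
  assumes \<phi>: "\<phi> \<in> auto H" and fixed: "\<And>x. x \<in> R \<Longrightarrow> \<phi> x = x"
  shows "rigid H R (link_of_aut H R \<phi>)"
proof -
  have "\<phi> ` R = R" using fixed by auto
  then show ?thesis
    using snd_link_of_aut[OF \<phi> _ R_Obj R_Obj] transporter_self[OF R_Obj] fixed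
    by (simp add: rigid_def link_delta_def link_class_def)
qed

text \<open>Equality of the two functors gives equality of cosets, and a trivial core turns this
  into equality of elements. One and the same \<open>h\<close> works for all such \<open>P\<close>;
  the contradiction at the end depends on this.\<close>

lemma link_Inn_conj:
  assumes \<phi>: "\<phi> \<in> auto H" "\<phi> ` R = R" and inner: "link_of_aut H R \<phi> \<in> link_Inn H R"
  obtains h where "h \<in> carrier H"
    "\<And>P g. P \<in> Obj L \<Longrightarrow> core P = {\<one>} \<Longrightarrow> g \<in> transporter H P P \<Longrightarrow> \<phi> g = h \<otimes> g \<otimes> inv h"
proof -
  obtain h where h: "h \<in> N" and eq: "link_of_aut H R \<phi> = link_of_aut H R (inn h)"
    using inner by (auto simp: link_Inn_eq)
  have hc: "h \<in> carrier H" using h N_carrier by simp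
  have "\<phi> g = h \<otimes> g \<otimes> inv h" if P: "P \<in> Obj L" "core P = {\<one>}" "g \<in> transporter H P P" for P g
  proof -
    have gc: "g \<in> carrier H" using P transporter_carrier by simp
    have 1: "core (\<phi> ` P) = {\<one>}"
      using auto_core[OF \<phi>(1) P(1) auto_Obj[OF \<phi> P(1)]] P(2) auto_one[OF \<phi>(1)] by simp
    have "\<phi> g <# core (\<phi> ` P) = inn h g <# core (inn h ` P)" "\<phi> ` P = inn h ` P"
      using snd_link_of_aut[OF \<phi> P(1,1,3)] snd_link_of_aut[OF inn_auto[OF hc] inn_R[OF h] P(1,1,3)] eq
      by auto
    then have "\<phi> g <# {\<one>} = inn h g <# {\<one>}" using 1 by simp
    then show ?thesis
      using auto_closed[OF \<phi>(1) gc] hc gc by (simp add: l_coset_def inn_def)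
  qed
  then show ?thesis using that hc by blast
qed

end


section \<open>Matrices of size two\<close>

definition mat2 :: "'a \<Rightarrow> 'a \<Rightarrow> 'a \<Rightarrow> 'a \<Rightarrow> ('a::zero) ^ 2 ^ 2" where
  "mat2 a b c d = vector [vector [a, b], vector [c, d]]"

lemma mat2_nth [simp]:
  "mat2 a b c d $ 1 $ 1 = a" "mat2 a b c d $ 1 $ 2 = b"
  "mat2 a b c d $ 2 $ 1 = c" "mat2 a b c d $ 2 $ 2 = d"
  by (simp_all add: mat2_def)

lemma mat2_eq_iff [simp]:
  "mat2 a b c d = mat2 a' b' c' d' \<longleftrightarrow> a = a' \<and> b = b' \<and> c = c' \<and> d = d'"
  by (auto simp: vec_eq_iff forall_2)

lemma mat2_cases: obtains a b c d where "A = mat2 a b c d"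
  by (rule that[of "A$1$1" "A$1$2" "A$2$1" "A$2$2"]) (simp add: vec_eq_iff forall_2)

lemma mat2_mult [simp]:
  fixes a :: "'a::semiring_1"
  shows "mat2 a b c d ** mat2 a' b' c' d' =
    mat2 (a * a' + b * c') (a * b' + b * d') (c * a' + d * c') (c * b' + d * d')"
  by (simp add: vec_eq_iff forall_2 matrix_matrix_mult_def sum_2)

lemma mat2_uminus [simp]: "- mat2 a b c d = mat2 (- a) (- b) (- c) (- d :: 'a::group_add)"
  by (simp add: vec_eq_iff forall_2)

lemma mat2_one: "mat 1 = mat2 1 0 0 (1 :: 'a::semiring_1)"
  by (simp add: vec_eq_iff forall_2 mat_def)

lemma det_mat2 [simp]: "det (mat2 a b c d) = a * d - b * (c :: 'a::comm_ring_1)"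
  by (simp add: det_2)

lemma mat2_SL2 [simp]: "mat2 a b c d \<in> carrier SL2 \<longleftrightarrow> a * d - b * c = (1::'a::field)"
  by (simp add: SL2_def)

lemma SL2_mult [simp]: "A \<otimes>\<^bsub>SL2\<^esub> B = A ** B"
  by (simp add: SL2_def)

lemma SL2_one: "\<one>\<^bsub>SL2\<^esub> = mat2 1 0 0 1"
  by (simp add: SL2_def mat2_one)

lemma SL2_group: "group (SL2 :: ('a::field ^ 2 ^ 2) monoid)"
proof (rule groupI)
  fix x :: "'a ^ 2 ^ 2" assume x: "x \<in> carrier SL2"
  obtain a b c d where "x = mat2 a b c d" by (rule mat2_cases)
  with x show "\<exists>y\<in>carrier SL2. y \<otimes>\<^bsub>SL2\<^esub> x = \<one>\<^bsub>SL2\<^esub>"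
    by (intro bexI[of _ "mat2 d (- b) (- c) a"]) (auto simp: SL2_one algebra_simps)
qed (auto simp: SL2_def det_mul matrix_mul_assoc)

interpretation SL2: group "SL2 :: ('a::field ^ 2 ^ 2) monoid"
  by (rule SL2_group)

lemma SL2_inv:
  fixes a :: "'a::field"
  assumes "a * d - b * c = 1"
  shows "inv\<^bsub>SL2\<^esub> (mat2 a b c d) = mat2 d (- b) (- c) a"
  by (rule SL2.inv_equality) (use assms in \<open>auto simp: SL2_one algebra_simps\<close>)

lemma center_SL2: "center (SL2 :: ('a::field ^ 2 ^ 2) monoid) = {mat 1, - mat 1}"
proof
  show "center (SL2 :: ('a ^ 2 ^ 2) monoid) \<subseteq> {mat 1, - mat 1}"
  proof
    fix A :: "'a ^ 2 ^ 2" assume A: "A \<in> center SL2"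
    obtain a b c d where A': "A = mat2 a b c d" by (rule mat2_cases)
    have comm: "A ** B = B ** A" if "B \<in> carrier SL2" for B
      using A that by (simp add: center_def centralizer_def)
    have "c = 0" "a = d" using comm[of "mat2 1 1 0 1"] by (auto simp: A')
    moreover have "b = 0" using comm[of "mat2 1 0 1 1"] by (auto simp: A')
    moreover have "a * d - b * c = 1" using A by (simp add: center_def centralizer_def A')
    ultimately have "a * a = 1" by simp
    then have "a = 1 \<or> a = -1" by (simp add: square_eq_1_iff)
    then show "A \<in> {mat 1, - mat 1}"
      using \<open>c = 0\<close> \<open>a = d\<close> \<open>b = 0\<close> by (auto simp: A' mat2_one)
  qed
  show "{mat 1, - mat 1} \<subseteq> center (SL2 :: ('a ^ 2 ^ 2) monoid)"
  proof -
    have "A ** B = B ** A" if "A \<in> {mat2 1 0 0 1, mat2 (- 1) 0 0 (- 1)}" for A B :: "'a ^ 2 ^ 2"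
      using that by (cases B rule: mat2_cases) auto
    then show ?thesis by (auto simp: center_def centralizer_def mat2_one)
  qed
qed

section \<open>The quotient by the center, with elements written as pairs of opposite
  matrices\<close>

abbreviation PSL2 :: "('a::field ^ 2 ^ 2) set monoid" where
  "PSL2 \<equiv> SL2 Mod center SL2"

definition pm :: "('a::field ^ 2 ^ 2) \<Rightarrow> ('a ^ 2 ^ 2) set" where
  "pm A = {A, - A}"

lemma neg_mult [simp]:
  fixes A B :: "'a::field ^ 2 ^ 2"
  shows "(- A) ** B = - (A ** B)" "A ** (- B) = - (A ** B)"
  by (cases A rule: mat2_cases; cases B rule: mat2_cases; simp)+

lemma neg_SL2 [simp]: "- A \<in> carrier SL2 \<longleftrightarrow> A \<in> carrier SL2"
  by (cases A rule: mat2_cases) simp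

lemma center_coset: "center SL2 #>\<^bsub>SL2\<^esub> A = pm A"
  by (auto simp: r_coset_def center_SL2 pm_def mat2_one[symmetric])

lemma pm_eq_iff: "pm A = pm B \<longleftrightarrow> A = B \<or> A = - B"
  by (auto simp: pm_def doubleton_eq_iff)

lemma pm_uminus [simp]: "pm (- A) = pm A"
  by (auto simp: pm_def)

lemma carrier_PSL2: "carrier PSL2 = pm ` carrier SL2"
  by (auto simp: FactGroup_def RCOSETS_def center_coset)

lemma pm_carrier [simp]: "A \<in> carrier SL2 \<Longrightarrow> pm A \<in> carrier PSL2"
  by (simp add: carrier_PSL2)

lemma pm_mult: "pm A <#>\<^bsub>SL2\<^esub> pm B = pm (A ** B)"
  by (auto simp: set_mult_def pm_def)

lemma PSL2_mult [simp]: "pm A \<otimes>\<^bsub>PSL2\<^esub> pm B = pm (A ** B)"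
  by (simp add: FactGroup_def pm_mult)

lemma center_normal: "center SL2 \<lhd> (SL2 :: ('a::field ^ 2 ^ 2) monoid)"
proof (rule SL2.normalI)
  have "subgroup {mat 1, - mat 1} (SL2 :: ('a ^ 2 ^ 2) monoid)"
  proof (rule SL2.subgroupI)
    fix A assume "A \<in> {mat 1, - mat 1 :: 'a ^ 2 ^ 2}"
    then show "inv\<^bsub>SL2\<^esub> A \<in> {mat 1, - mat 1}" by (auto simp: mat2_one SL2_inv)
  qed (auto simp: mat2_one)
  then show "subgroup (center SL2) (SL2 :: ('a ^ 2 ^ 2) monoid)" by (simp add: center_SL2)
  show "\<forall>x\<in>carrier SL2. center SL2 #>\<^bsub>SL2\<^esub> x = x <#\<^bsub>SL2\<^esub> center (SL2 :: ('a ^ 2 ^ 2) monoid)"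
    by (auto simp: r_coset_def l_coset_def center_SL2)
qed

interpretation PSL2: group "PSL2 :: ('a::field ^ 2 ^ 2) set monoid"
  by (rule normal.factorgroup_is_group[OF center_normal])

lemma pm_hom: "group_hom SL2 PSL2 (pm :: 'a::field ^ 2 ^ 2 \<Rightarrow> _)"
  by (auto intro!: homI simp: group_hom_def group_hom_axioms_def SL2_group PSL2.is_group pm_mult)

lemma PSL2_one: "\<one>\<^bsub>PSL2\<^esub> = pm (mat2 1 0 0 1)"
  by (simp add: FactGroup_def center_SL2 pm_def mat2_one)

lemma PSL2_inv: "A \<in> carrier SL2 \<Longrightarrow> inv\<^bsub>PSL2\<^esub> (pm A) = pm (inv\<^bsub>SL2\<^esub> A)"
  by (rule group_hom.hom_inv[OF pm_hom, symmetric])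


subsection \<open>Monomial matrices\<close>

definition dg :: "'a \<Rightarrow> 'a::field ^ 2 ^ 2" where "dg u = mat2 u 0 0 (inverse u)"
text \<open>\<open>ad u\<close> is \<open>dg u\<close> times the Weyl element
  \<open>ad 1\<close>.\<close>

definition ad :: "'a \<Rightarrow> 'a::field ^ 2 ^ 2" where "ad u = mat2 0 u (- inverse u) 0"

lemma dg_ad_SL2 [simp]: "dg u \<in> carrier SL2 \<longleftrightarrow> u \<noteq> 0" "ad u \<in> carrier SL2 \<longleftrightarrow> u \<noteq> 0"
  by (cases "u = 0"; simp add: dg_def ad_def)+

lemma dg_ad_eq [simp]:
  "dg u = dg v \<longleftrightarrow> u = v" "ad u = ad v \<longleftrightarrow> u = v"
  "u \<noteq> 0 \<or> v \<noteq> 0 \<Longrightarrow> dg u \<noteq> ad v" "u \<noteq> 0 \<or> v \<noteq> 0 \<Longrightarrow> ad v \<noteq> dg u"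
  by (auto simp: dg_def ad_def)

lemma dg_ad_mult [simp]:
  "dg u ** dg v = dg (u * v)" "dg u ** ad v = ad (u * v)"
  "ad u ** dg v = ad (u / v)" "ad u ** ad v = dg (- (u / v))"
  by (auto simp: dg_def ad_def divide_simps)

lemma dg_ad_uminus: "- dg u = dg (- u)" "- ad u = ad (- u)"
  by (auto simp: dg_def ad_def)

lemma dg_ad_inv:
  assumes "u \<noteq> 0"
  shows "inv\<^bsub>SL2\<^esub> (dg u) = dg (inverse u)" "inv\<^bsub>SL2\<^esub> (ad u) = ad (- u)"
  using assms by (simp_all add: dg_def ad_def SL2_inv)

lemma SL2_diag_eq: "SL2_diag = dg ` (UNIV - {0 :: 'a::field})"
proof (rule Set.set_eqI)
  fix A :: "'a ^ 2 ^ 2"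
  obtain a b c d where A: "A = mat2 a b c d" by (rule mat2_cases)
  have "A \<in> SL2_diag \<longleftrightarrow> a * d = 1 \<and> b = 0 \<and> c = 0"
    by (auto simp: SL2_diag_def A forall_2)
  also have "\<dots> \<longleftrightarrow> A \<in> dg ` (UNIV - {0})"
    by (auto simp: A dg_def image_iff field_simps intro: bexI[of _ a])
  finally show "A \<in> SL2_diag \<longleftrightarrow> A \<in> dg ` (UNIV - {0})" .
qed

text \<open>For a multiplicative group \<open>D\<close> containing -1, this is the group generated
  by the diagonal matrices over \<open>D\<close> and \<open>ad e\<close>. One formula covers the
  full normalizer of the torus, its Sylow 2-subgroups and the quaternion groups below.\<close>

definition monomial :: "'a set \<Rightarrow> 'a \<Rightarrow> ('a::field ^ 2 ^ 2) set" where
  "monomial D e = dg ` D \<union> (\<lambda>d. ad (d * e)) ` D"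

text \<open>The hypothesis on \<open>z\<close> makes \<open>dg z\<close> a matrix with two distinct
  eigenvalues. A matrix that conjugates it to a diagonal one must fix or swap the two coordinate
  axes.\<close>

lemma normalizer_diag:
  assumes z: "z \<noteq> (0::'a::field)" "z * z \<noteq> 1"
  shows "normalizer SL2 (SL2_diag :: ('a ^ 2 ^ 2) set) = monomial (UNIV - {0}) 1"
proof -
  let ?T = "SL2_diag :: ('a ^ 2 ^ 2) set"
  have Tsub: "?T \<subseteq> carrier SL2" by (auto simp: SL2_diag_def)
  have conj: "A <#\<^bsub>SL2\<^esub> ?T #>\<^bsub>SL2\<^esub> inv\<^bsub>SL2\<^esub> A = (\<lambda>t. A ** t ** inv\<^bsub>SL2\<^esub> A) ` ?T" for A
    by (auto simp: l_coset_def r_coset_def)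
  have norm: "normalizer SL2 ?T = {A \<in> carrier SL2. (\<lambda>t. A ** t ** inv\<^bsub>SL2\<^esub> A) ` ?T = ?T}"
    unfolding normalizer_def stabilizer_def using Tsub conj by auto
  show ?thesis
  proof
    show "normalizer SL2 ?T \<subseteq> monomial (UNIV - {0}) 1"
    proof
      fix A assume "A \<in> normalizer SL2 ?T"
      then have A: "A \<in> carrier SL2" and im: "(\<lambda>t. A ** t ** inv\<^bsub>SL2\<^esub> A) ` ?T = ?T"
        by (auto simp: norm)
      obtain a b c d where A': "A = mat2 a b c d" by (rule mat2_cases)
      have det: "a * d - b * c = 1" using A by (simp add: A')
      have "dg z \<in> ?T" using z by (simp add: SL2_diag_eq)
      then have "A ** dg z ** inv\<^bsub>SL2\<^esub> A \<in> ?T" using im by blast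
      then obtain y where y: "y \<noteq> 0" "A ** dg z ** inv\<^bsub>SL2\<^esub> A = dg y" by (auto simp: SL2_diag_eq)
      have "A \<otimes>\<^bsub>SL2\<^esub> dg z = dg y \<otimes>\<^bsub>SL2\<^esub> A"
        using y z A SL2.inv_solve_right'[of "dg y" "A ** dg z" A]
        by (metis SL2.inv_closed SL2.inv_inv SL2.inv_solve_right SL2.m_closed SL2_mult dg_ad_SL2(1))
      then have e: "a * z = y * a" "b * inverse z = y * b" "c * z = inverse y * c" "d * inverse z = inverse y * d"
        by (auto simp: A' dg_def)
      \<comment> \<open>If \<open>a\<close> and \<open>b\<close> were both nonzero, \<open>y\<close>
        would equal both \<open>z\<close> and its inverse, contrary to
        \<open>z * z \<noteq> 1\<close>.\<close>
      have "a = 0 \<or> b = 0" using e(1,2) z y by (auto simp: field_simps)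
      moreover have "c = 0 \<or> d = 0" using e(3,4) z y by (auto simp: field_simps)
      ultimately have "(b = 0 \<and> c = 0 \<and> a * d = 1) \<or> (a = 0 \<and> d = 0 \<and> - b * c = 1)"
        using det by auto
      then show "A \<in> monomial (UNIV - {0}) 1"
      proof
        assume h: "b = 0 \<and> c = 0 \<and> a * d = 1"
        then have "d = inverse a" using inverse_unique[of a d] by simp
        with h have "A = dg a" "a \<noteq> 0" by (auto simp: A' dg_def)
        then show ?thesis by (auto simp: monomial_def)
      next
        assume h: "a = 0 \<and> d = 0 \<and> - b * c = 1"
        then have "b \<noteq> 0" by auto
        moreover have "c = - inverse b" using h inverse_unique[of b "- c"] by simp
        ultimately have "A = ad b" "b \<noteq> 0" using h by (auto simp: A' ad_def)
        then show ?thesis by (auto simp: monomial_def)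
      qed
    qed
    show "monomial (UNIV - {0}) 1 \<subseteq> normalizer SL2 ?T"
    proof
      fix A :: "'a ^ 2 ^ 2" assume "A \<in> monomial (UNIV - {0}) 1"
      then consider u where "u \<noteq> 0" "A = dg u" | u where "u \<noteq> 0" "A = ad u"
        by (auto simp: monomial_def)
      then show "A \<in> normalizer SL2 ?T"
      proof cases
        case 1
        then have "(\<lambda>t. A ** t ** inv\<^bsub>SL2\<^esub> A) ` ?T = (\<lambda>t. t) ` ?T"
          by (intro image_cong refl) (auto simp: SL2_diag_eq dg_ad_inv)
        then show ?thesis using 1 by (simp add: norm)
      next
        case 2
        have "(\<lambda>t. A ** t ** inv\<^bsub>SL2\<^esub> A) ` ?T = (\<lambda>x. dg (inverse x)) ` (UNIV - {0})"
          unfolding SL2_diag_eq image_image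
          by (intro image_cong refl) (use 2 in \<open>auto simp: dg_ad_inv field_simps\<close>)
        also have "\<dots> = dg ` inverse ` (UNIV - {0})" by (simp add: image_image)
        also have "inverse ` (UNIV - {0 :: 'a}) = UNIV - {0}"
        proof
          show "UNIV - {0} \<subseteq> inverse ` (UNIV - {0 :: 'a})"
            by (rule subsetI, rule_tac x = "inverse x" in image_eqI) auto
        qed auto
        finally have "(\<lambda>t. A ** t ** inv\<^bsub>SL2\<^esub> A) ` ?T = ?T" by (simp only: SL2_diag_eq)
        then show ?thesis using 2 by (simp add: norm)
      qed
    qed
  qed
qed

text \<open>The element -1 has to belong to \<open>D\<close> because a product of two antidiagonal
  matrices brings in a sign.\<close>

lemma monomial_subgroup:
  assumes "1 \<in> D" "- 1 \<in> D" "\<And>x y. x \<in> D \<Longrightarrow> y \<in> D \<Longrightarrow> x * y \<in> D"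
    "\<And>x. x \<in> D \<Longrightarrow> inverse x \<in> D" "0 \<notin> D" "e \<noteq> 0"
  shows "subgroup (monomial D e) SL2"
proof (rule SL2.subgroupI)
  have D0: "x \<noteq> 0" if "x \<in> D" for x using that assms(5) by auto
  have neg: "- x \<in> D" if "x \<in> D" for x using assms(3)[OF assms(2) that] by simp
  show "monomial D e \<subseteq> carrier SL2" using D0 assms(6) by (auto simp: monomial_def)
  show "monomial D e \<noteq> {}" using assms(1) by (auto simp: monomial_def)
  show "inv\<^bsub>SL2\<^esub> A \<in> monomial D e" if A: "A \<in> monomial D e" for A
  proof -
    consider u where "u \<in> D" "A = dg u" | u where "u \<in> D" "A = ad (u * e)"
      using A by (auto simp: monomial_def)
    then show ?thesis
    proof cases
      case 1
      then show ?thesis using assms(4) D0 by (auto simp: dg_ad_inv monomial_def)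
    next
      case 2
      have "inv\<^bsub>SL2\<^esub> A = ad (- u * e)" using 2 D0 assms(6) by (simp add: dg_ad_inv)
      then show ?thesis using neg[OF 2(1)] unfolding monomial_def by blast
    qed
  qed
  show "A \<otimes>\<^bsub>SL2\<^esub> B \<in> monomial D e" if AB: "A \<in> monomial D e" "B \<in> monomial D e" for A B
  proof -
    have div: "x / y \<in> D" if "x \<in> D" "y \<in> D" for x y
      using assms(3,4) that by (simp add: divide_inverse)
    consider u v where "u \<in> D" "v \<in> D" "A = dg u" "B = dg v"
      | u v where "u \<in> D" "v \<in> D" "A = dg u" "B = ad (v * e)"
      | u v where "u \<in> D" "v \<in> D" "A = ad (u * e)" "B = dg v"
      | u v where "u \<in> D" "v \<in> D" "A = ad (u * e)" "B = ad (v * e)"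
      using AB unfolding monomial_def by blast
    then show ?thesis
    proof cases
      case 1 then show ?thesis using assms(3) by (auto simp: monomial_def)
    next
      case 2
      then have "A ** B = ad ((u * v) * e)" by (simp add: mult.assoc)
      then show ?thesis using assms(3) 2 by (auto simp: monomial_def)
    next
      case 3
      then have eq: "A ** B = ad ((u / v) * e)" by simp
      show ?thesis using div[OF 3(1,2)] unfolding SL2_mult eq monomial_def by blast
    next
      case 4
      then have "A ** B = dg (- (u / v))" using assms(6) by simp
      then show ?thesis using neg div 4 by (auto simp: monomial_def)
    qed
  qed
qed

lemma card_monomial:
  assumes "finite D" "0 \<notin> D" "e \<noteq> 0"
  shows "card (monomial D e) = 2 * card D"
proof -
  have "card (dg ` D) = card D" by (rule card_image) (auto simp: inj_on_def)
  moreover have "card ((\<lambda>d. ad (d * e)) ` D) = card D"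
    using assms by (intro card_image) (auto simp: inj_on_def)
  moreover have "dg ` D \<inter> (\<lambda>d. ad (d * e)) ` D = {}"
    using assms(2) by (auto simp: dg_def ad_def)
  ultimately show ?thesis
    unfolding monomial_def using assms by (subst card_Un_disjoint) auto
qed

text \<open>Closure under negation and characteristic other than 2 make every fibre of
  \<open>pm\<close> a pair inside the monomial group. This halving cancels the factor 2 of
  \<open>card_monomial\<close>.\<close>

lemma card_pm_monomial:
  assumes D: "finite D" "0 \<notin> D" "\<And>x. x \<in> D \<Longrightarrow> - x \<in> D" and e: "e \<noteq> (0::'a::field)"
    and two: "(2::'a) \<noteq> 0"
  shows "card (pm ` monomial D e) = card D"
proof -
  let ?M = "monomial D e"
  have neg: "- A \<in> ?M" if A: "A \<in> ?M" for A
  proof -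
    consider x where "x \<in> D" "A = dg x" | x where "x \<in> D" "A = ad (x * e)"
      using A unfolding monomial_def by blast
    then show ?thesis
    proof cases
      case 1
      then show ?thesis using D(3) by (simp add: monomial_def dg_ad_uminus)
    next
      case 2
      then have "- A = ad (- x * e)" by (simp add: dg_ad_uminus)
      then show ?thesis using D(3)[OF 2(1)] unfolding monomial_def by blast
    qed
  qed
  have U: "\<Union> (pm ` ?M) = ?M" using neg by (auto simp: pm_def)
  have ne: "A \<noteq> - A" if A: "A \<in> ?M" for A
  proof -
    have x2: "x \<noteq> - x" if "x \<noteq> 0" for x :: 'a
      using that two by (metis add.right_inverse mult_2 mult_eq_0_iff)
    consider x where "x \<in> D" "A = dg x" | x where "x \<in> D" "A = ad (x * e)"
      using A unfolding monomial_def by blast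
    then obtain x where "x \<noteq> 0" "A = dg x \<or> A = ad x"
      using D(2) e by cases (metis mult_eq_0_iff)+
    then show ?thesis using x2[of x] by (metis dg_ad_uminus dg_ad_eq(1,2))
  qed
  have "2 * card (pm ` ?M) = card (\<Union> (pm ` ?M))"
  proof (rule card_partition)
    show "card c = 2" if "c \<in> pm ` ?M" for c
      using that ne by (auto simp: pm_def)
    show "c1 \<inter> c2 = {}" if "c1 \<in> pm ` ?M" "c2 \<in> pm ` ?M" "c1 \<noteq> c2" for c1 c2
      using that by (auto simp: pm_def)
  qed (use D U in \<open>auto simp: monomial_def\<close>)
  then show ?thesis using card_monomial[OF D(1,2) e] U by simp
qed

section \<open>Roots of unity and Sylow 2-subgroups of the normalizer of the torus\<close>

lemma dg_nat_pow: "dg u [^]\<^bsub>SL2\<^esub> (n::nat) = dg (u ^ n)"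
proof (induction n)
  case 0
  show ?case by (simp add: SL2_one dg_def)
qed (simp add: mult.commute)

lemma roots_of_unity:
  assumes "m > 0"
  shows "card {x::'a::field. x ^ m = 1} \<le> m" and "finite {x::'a. x ^ m = 1}"
proof -
  let ?p = "Polynomial.monom 1 m - 1 :: 'a poly"
  have "poly ?p 0 \<noteq> 0" using assms by (simp add: Polynomial.poly_monom power_0_left)
  then have p0: "?p \<noteq> 0" by auto
  have "{x. x ^ m = 1} = {x. poly ?p x = 0}" by (simp add: Polynomial.poly_monom)
  then have "card {x::'a. x ^ m = 1} \<le> Polynomial.degree ?p"
    using card_poly_roots_bound[OF p0] by simp
  also have "\<dots> \<le> m"
    by (rule degree_diff_le) (simp_all add: Polynomial.degree_monom_le)
  finally show "card {x::'a. x ^ m = 1} \<le> m" .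
  show "finite {x::'a. x ^ m = 1}"
    using poly_roots_finite[OF p0] \<open>{x. x ^ m = 1} = {x. poly ?p x = 0}\<close> by simp
qed

text \<open>The normalizer has order 2(q - 1), so \<open>S\<close> has order 2^(n+1). Its diagonal
  part is a 2-group of order dividing q - 1, and its antidiagonal part, once nonempty, is a
  translate of the diagonal part. Since \<open>S\<close> is an arbitrary Sylow subgroup, the
  translating parameter \<open>e\<close> is an arbitrary nonzero element and has to be carried
  along.\<close>

lemma sylow_normalizer_diag:
  fixes S :: "('k::{field,finite} ^ 2 ^ 2) set"
  assumes S: "S \<in> Syl2 (SL2\<lparr>carrier := normalizer SL2 SL2_diag\<rparr>)"
    and n: "n = multiplicity 2 (CARD('k) - 1)" and q: "CARD('k) > 3" "odd CARD('k)"
  obtains D e where "S = monomial D e" "card D = 2 ^ n" "e \<noteq> 0" "0 \<notin> D" "1 \<in> D"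
    "\<And>x y. x \<in> D \<Longrightarrow> y \<in> D \<Longrightarrow> x * y \<in> D" "\<And>x. x \<in> D \<Longrightarrow> inverse x \<in> D"
    "\<And>x. x \<in> D \<Longrightarrow> x ^ (2 ^ n) = 1" "subgroup S SL2"
proof -
  let ?U = "UNIV - {0 :: 'k}"
  have cU: "card ?U = CARD('k) - 1" by (simp add: card_Diff_singleton)
  have "\<exists>z::'k. z \<noteq> 0 \<and> z * z \<noteq> 1"
  proof (rule ccontr)
    assume "\<not> ?thesis"
    then have "UNIV \<subseteq> {0, 1, - 1 :: 'k}" by (auto simp: square_eq_1_iff)
    then have "CARD('k) \<le> card {0, 1, - 1 :: 'k}" by (intro card_mono) auto
    also have "\<dots> \<le> 3" by (simp add: card_insert_if)
    finally show False using q by simp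
  qed
  then obtain z :: 'k where z: "z \<noteq> 0" "z * z \<noteq> 1" by blast
  define N where "N = normalizer SL2 (SL2_diag :: ('k ^ 2 ^ 2) set)"
  have N: "N = monomial ?U 1" unfolding N_def using normalizer_diag[OF z] .
  have cN: "card N = 2 * (CARD('k) - 1)" unfolding N using card_monomial[of ?U 1] cU by simp
  have "subgroup N SL2" unfolding N_def
    by (rule SL2.normalizer_imp_subgroup) (auto simp: SL2_diag_def)
  then have Ssub: "subgroup S SL2" using S SL2.incl_subgroup by (auto simp: Syl2_def N_def)
  have SN: "S \<subseteq> N" using S subgroup.subset[of S] by (fastforce simp: Syl2_def N_def)
  have "card S = 2 ^ multiplicity 2 (card N)" using S by (auto simp: Syl2_def N_def order_def)
  also have "multiplicity 2 (card N) = Suc n"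
    unfolding cN n using q by (subst multiplicity_times_same) auto
  finally have cS: "card S = 2 ^ Suc n" .
  define D where "D = {u. u \<noteq> 0 \<and> dg u \<in> S}"
  define E where "E = {u. u \<noteq> 0 \<and> ad u \<in> S}"
  have Seq: "S = dg ` D \<union> ad ` E"
    using SN by (auto simp: D_def E_def N monomial_def subset_iff)
  have mem: "A \<otimes>\<^bsub>SL2\<^esub> B \<in> S" "inv\<^bsub>SL2\<^esub> A \<in> S" if "A \<in> S" "B \<in> S" for A B
    using that subgroup.m_closed[OF Ssub] subgroup.m_inv_closed[OF Ssub] by blast+
  have D1: "1 \<in> D" using subgroup.one_closed[OF Ssub] by (simp add: D_def dg_def SL2_one)
  have Dm: "x * y \<in> D" if "x \<in> D" "y \<in> D" for x y
    using mem(1)[of "dg x" "dg y"] that by (simp add: D_def)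
  have Di: "inverse x \<in> D" if "x \<in> D" for x
    using mem(2)[of "dg x" "dg x"] that by (auto simp: D_def dg_ad_inv)
  have D0: "0 \<notin> D" by (simp add: D_def)
  have sD: "subgroup (dg ` D) SL2"
    using D1 Dm Di D0 by (intro SL2.subgroupI) (auto simp: D_def dg_ad_inv intro: exI[of _ 1])
  have sU: "subgroup (dg ` ?U) SL2"
  proof (rule SL2.subgroupI)
    have "dg 1 \<in> dg ` ?U" by simp
    then show "dg ` ?U \<noteq> {}" by (metis empty_iff)
  qed (auto simp: dg_ad_inv)
  have cdg: "card (dg ` X) = card X" for X :: "'k set"
    by (rule card_image) (auto simp: inj_on_def)
  have dS: "card D dvd card S"
  proof -
    interpret S: group "SL2\<lparr>carrier := S\<rparr>" using subgroup.subgroup_is_group[OF Ssub SL2.is_group] .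
    have "subgroup (dg ` D) (SL2\<lparr>carrier := S\<rparr>)"
      by (rule SL2.subgroup_incl[OF sD Ssub]) (auto simp: Seq)
    from S.lagrange[OF this] show ?thesis by (simp add: order_def cdg) (metis dvd_triv_right)
  qed
  have dU: "card D dvd CARD('k) - 1"
  proof -
    interpret U: group "SL2\<lparr>carrier := dg ` ?U\<rparr>" using subgroup.subgroup_is_group[OF sU SL2.is_group] .
    have "subgroup (dg ` D) (SL2\<lparr>carrier := dg ` ?U\<rparr>)"
      by (rule SL2.subgroup_incl[OF sD sU]) (auto simp: D_def)
    from U.lagrange[OF this] show ?thesis by (simp add: order_def cdg cU) (metis dvd_triv_right)
  qed
  obtain m where m: "card D = 2 ^ m"
    using dS unfolding cS using divides_primepow_nat two_is_prime_nat by blast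
  have "m \<le> n" unfolding n using dU m q by (intro multiplicity_geI) auto
  have card_SE: "card S = card D + card E"
  proof -
    have "dg ` D \<inter> ad ` E = {}" by (auto simp: dg_def ad_def D_def)
    moreover have "card (ad ` E) = card E" by (rule card_image) (auto simp: inj_on_def)
    ultimately show ?thesis unfolding Seq by (subst card_Un_disjoint) (auto simp: cdg)
  qed
  \<comment> \<open>A purely diagonal \<open>S\<close> would have 2^(n+1) elements, more than the
    2-part of q - 1 allows.\<close>
  have "E \<noteq> {}"
  proof
    assume "E = {}"
    then have "(2::nat) ^ Suc n = 2 ^ m" using card_SE cS m by simp
    then have "Suc n = m" using power_inject_exp[of "2::nat" "Suc n" m] by linarith
    then show False using \<open>m \<le> n\<close> by simp
  qed
  then obtain e where e: "e \<in> E" by blast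
  then have e0: "e \<noteq> 0" by (simp add: E_def)
  have ED: "E = (\<lambda>d. d * e) ` D"
  proof
    show "(\<lambda>d. d * e) ` D \<subseteq> E"
    proof
      fix x assume "x \<in> (\<lambda>d. d * e) ` D"
      then obtain d where "d \<in> D" "x = d * e" by blast
      then show "x \<in> E" using mem(1)[of "dg d" "ad e"] e by (simp add: D_def E_def)
    qed
    show "E \<subseteq> (\<lambda>d. d * e) ` D"
    proof
      fix x assume x: "x \<in> E"
      have "ad x ** ad (- e) \<in> S"
        using mem(1)[of "ad x" "ad (- e)"] mem(2)[of "ad e" "ad e"] x e by (simp add: E_def dg_ad_inv)
      then have "x / e \<in> D" using x e0 by (simp add: D_def E_def)
      moreover have "x = x / e * e" using e0 by simp
      ultimately show "x \<in> (\<lambda>d. d * e) ` D" by blast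
    qed
  qed
  have "card E = card D" unfolding ED by (rule card_image) (auto simp: inj_on_def e0)
  then have cD: "card D = 2 ^ n" using card_SE cS by simp
  have pow: "x ^ (2 ^ n) = 1" if x: "x \<in> D" for x
  proof -
    interpret D: group "SL2\<lparr>carrier := dg ` D\<rparr>" using subgroup.subgroup_is_group[OF sD SL2.is_group] .
    have "dg x [^]\<^bsub>SL2\<lparr>carrier := dg ` D\<rparr>\<^esub> order (SL2\<lparr>carrier := dg ` D\<rparr>) = \<one>\<^bsub>SL2\<^esub>"
      using D.pow_order_eq_1[of "dg x"] x by simp
    then have "dg x [^]\<^bsub>SL2\<^esub> (2 ^ n :: nat) = \<one>\<^bsub>SL2\<^esub>"
      by (simp add: order_def cdg cD nat_pow_def)
    then show ?thesis by (simp only: dg_nat_pow) (simp add: dg_def SL2_one)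
  qed
  have "S = monomial D e" unfolding Seq ED monomial_def by (simp add: image_image)
  then show ?thesis using that cD e0 D0 D1 Dm Di pow Ssub by blast
qed

text \<open>The equation x^(2^m) = 1 has at most 2^m solutions in a field, too few for
  \<open>D\<close>. For any other \<open>z\<close> in \<open>D\<close> the power is a square root of
  1 different from 1.\<close>

lemma order_two_power_element:
  assumes D: "finite D" "card D = 2 ^ Suc m" "\<And>x. x \<in> D \<Longrightarrow> x ^ (2 ^ Suc m) = (1::'a::field)"
  obtains z where "z \<in> D" "z ^ (2 ^ m) = - 1"
proof -
  have "\<exists>z\<in>D. z ^ (2 ^ m) \<noteq> 1"
  proof (rule ccontr)
    assume "\<not> ?thesis"
    then have sub: "D \<subseteq> {x. x ^ (2 ^ m) = 1}" by auto
    have "card D \<le> 2 ^ m"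
      using card_mono[OF roots_of_unity(2) sub] roots_of_unity(1)[of "2 ^ m", where ?'a = 'a] by simp
    then show False using D(2) by simp
  qed
  then obtain z where z: "z \<in> D" "z ^ (2 ^ m) \<noteq> 1" by blast
  have "(z ^ (2 ^ m)) * (z ^ (2 ^ m)) = 1"
    using D(3)[OF z(1)] by (simp add: power_add[symmetric] mult_2[symmetric])
  then have "z ^ (2 ^ m) = - 1" using z(2) by (simp add: square_eq_1_iff)
  then show ?thesis using that z by blast
qed


subsection \<open>Four-groups\<close>

text \<open>The equation \<open>h + h = 1\<close> says in one stroke that 2 is invertible and that
  \<open>h\<close> is its inverse.\<close>

context
  fixes i h :: "'a::field"
  assumes i: "i * i = - 1" and h: "h + h = 1"
begin

text \<open>The quaternion group of order 8 generated by \<open>dg i\<close> and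
  \<open>ad u\<close>; its image modulo the center is a four-group.\<close>

definition quat :: "'a \<Rightarrow> ('a ^ 2 ^ 2) set" where
  "quat u = monomial {1, - 1, i, - i} u"

text \<open>With \<open>I = dg i\<close>, \<open>J = ad u\<close>, \<open>K = I J\<close> and \<open>h = 1/2\<close>, this is \<open>h (1 + I + J + K)\<close>, which permutes
  \<open>I, J, K\<close> cyclically.\<close>

definition rot :: "'a \<Rightarrow> 'a ^ 2 ^ 2" where
  "rot u = mat2 (h * (1 + i)) (u * (h * (1 + i))) (- (h * (1 - i) * inverse u)) (h * (1 - i))"

lemma two: "(2::'a) \<noteq> 0"
  using h by (metis mult_2 mult_zero_left zero_neq_one)

lemma i_nonzero: "i \<noteq> 0"
  using i by auto

lemma inverse_i: "inverse i = - i"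
  using i inverse_unique[of i "- i"] by simp

lemma one_plus_i: "1 + i \<noteq> 0"
proof
  assume "1 + i = 0"
  then have "i = - 1" by (simp add: eq_neg_iff_add_eq_0 add.commute)
  then have "(2::'a) = 0" using i by simp
  then show False using two by simp
qed

lemma neg_one_neq: "(- 1 :: 'a) \<noteq> 1"
  using two by (metis add.right_inverse one_add_one)

lemma quat_subgroup: "u \<noteq> 0 \<Longrightarrow> subgroup (quat u) SL2"
  unfolding quat_def
  by (rule monomial_subgroup) (auto simp: i inverse_i i_nonzero)

lemma card_pm_quat:
  assumes u: "u \<noteq> 0"
  shows "card (pm ` quat u) = 2 ^ 2"
proof -
  have "card (pm ` quat u) = card {1, - 1, i, - i}"
    unfolding quat_def using u two i_nonzero by (intro card_pm_monomial) auto
  also have "\<dots> = 4"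
  proof -
    have "i \<noteq> 1" "i \<noteq> - 1" using i neg_one_neq by auto
    moreover have "i \<noteq> - i" using i_nonzero two by (metis add.right_inverse mult_2 mult_eq_0_iff)
    ultimately show ?thesis using neg_one_neq by (auto simp: card_insert_if minus_equation_iff)
  qed
  finally show ?thesis by simp
qed

text \<open>Commuting modulo the center means commuting up to sign. Up to sign, commuting with
  \<open>dg i\<close> forces a diagonal or antidiagonal matrix, and commuting with
  \<open>ad u\<close> then forces the square of its parameter, relative to \<open>u\<close> in the
  antidiagonal case, to be 1 or -1.\<close>

lemma centralizer_quat:
  assumes u: "u \<noteq> 0"
  shows "centralizer PSL2 (pm ` quat u) \<subseteq> pm ` quat u"
proof
  fix X assume X: "X \<in> centralizer PSL2 (pm ` quat u)"
  then obtain A where A: "A \<in> carrier SL2" "X = pm A"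
    by (auto simp: centralizer_def carrier_PSL2)
  obtain a b c d where A': "A = mat2 a b c d" by (rule mat2_cases)
  have comm: "A ** B = B ** A \<or> A ** B = - (B ** A)" if "B \<in> quat u" for B
    using X that by (auto simp: centralizer_def A(2) pm_mult pm_eq_iff)
  have det: "a * d - b * c = 1" using A by (simp add: A')
  have neq: "i * x = - (i * x) \<longleftrightarrow> x = 0" "- (i * x) = i * x \<longleftrightarrow> x = 0" for x
    using i_nonzero two by (metis add.right_inverse mult_2 mult_eq_0_iff neg_equal_0_iff_equal mult_zero_right minus_zero)+
  have "dg i \<in> quat u" by (simp add: quat_def monomial_def)
  from comm[OF this] have "(b = 0 \<and> c = 0) \<or> (a = 0 \<and> d = 0)"
    by (auto simp: A' dg_def inverse_i neq mult.commute[of _ i])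
  then have "(\<exists>x. x \<noteq> 0 \<and> A = dg x) \<or> (\<exists>x. x \<noteq> 0 \<and> A = ad x)"
  proof
    assume h: "b = 0 \<and> c = 0"
    then have "a \<noteq> 0" "A = dg a" using det inverse_unique[of a d] by (auto simp: A' dg_def)
    then show ?thesis by blast
  next
    assume h: "a = 0 \<and> d = 0"
    then have "b * (- c) = 1" using det by simp
    then have "b \<noteq> 0" "A = ad b" using h inverse_unique[of b "- c"] by (auto simp: A' ad_def)
    then show ?thesis by blast
  qed
  moreover have mem: "ad u \<in> quat u" by (simp add: quat_def monomial_def)
  have root: "x \<in> {1, - 1, i, - i}" if "x * x = 1 \<or> x * x = - 1" for x
  proof -
    have "x * x = - 1 \<longleftrightarrow> x * x = i * i" by (simp add: i)
    then show ?thesis using that by (auto simp: square_eq_1_iff square_eq_iff)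
  qed
  ultimately consider x where "x \<noteq> 0" "A = dg x" | x where "x \<noteq> 0" "A = ad x" by blast
  then have "A \<in> quat u"
  proof cases
    case 1
    have "x * u = u / x \<or> x * u = - (u / x)"
      using comm[OF mem] by (simp add: 1 dg_ad_uminus)
    then have "x * x * u = 1 * u \<or> x * x * u = - 1 * u" using 1 by (auto simp: field_simps)
    then have "x * x = 1 \<or> x * x = - 1" by (simp only: mult_right_cancel[OF u])
    then show ?thesis using root[of x] 1 by (auto simp: quat_def monomial_def)
  next
    case 2
    have "x / u = u / x \<or> x / u = - (u / x)"
    proof -
      have "- (x / u) = - (u / x) \<or> - (x / u) = u / x"
        using comm[OF mem] by (simp add: 2 dg_ad_uminus)
      then show ?thesis by (metis minus_minus)
    qed
    then have "x / u * (x / u) = 1 \<or> x / u * (x / u) = - 1" using 2 u by (auto simp: field_simps)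
    then have "x / u \<in> {1, - 1, i, - i}" by (rule root)
    moreover have "A = ad (x / u * u)" using u 2 by simp
    ultimately show ?thesis unfolding quat_def monomial_def by blast
  qed
  then show "X \<in> pm ` quat u" using A by simp
qed

lemma rot_SL2:
  assumes u: "u \<noteq> 0"
  shows "rot u \<in> carrier SL2"
proof -
  have "h * (1 + i) * (h * (1 - i)) = h * (h * (1 - i * i))" by (simp add: algebra_simps)
  also have "\<dots> = h * (h + h)" by (simp add: i algebra_simps)
  finally have 1: "h * (1 + i) * (h * (1 - i)) = h" by (simp add: h)
  have 2: "u * (h * (1 + i)) * (- (h * (1 - i) * inverse u)) = - (h * (1 + i) * (h * (1 - i)))"
    using u by (simp add: field_simps)
  show ?thesis unfolding rot_def mat2_SL2 2 1 by (simp add: h)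
qed

lemma rot_conj:
  assumes "u \<noteq> 0"
  shows "rot u ** dg i = ad u ** rot u" "rot u ** ad u = ad (i * u) ** rot u"
    "rot u ** ad (i * u) = dg i ** rot u"
proof -
  have ii: "i * (i * x) = - x" for x by (simp add: mult.assoc[symmetric] i)
  show "rot u ** dg i = ad u ** rot u" "rot u ** ad u = ad (i * u) ** rot u"
    "rot u ** ad (i * u) = dg i ** rot u"
    using assms i_nonzero by (simp_all add: rot_def dg_def ad_def inverse_i field_simps i ii)
qed

lemma pm_quat: "pm ` quat u = {pm (dg 1), pm (dg i), pm (ad u), pm (ad (i * u))}"
proof -
  have "quat u = {dg 1, - dg 1, dg i, - dg i, ad u, - ad u, ad (i * u), - ad (i * u)}"
    by (auto simp: quat_def monomial_def dg_ad_uminus)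
  then show ?thesis by (simp only: image_insert image_empty pm_uminus) auto
qed

end


section \<open>Field automorphisms\<close>

text \<open>From s = 1 mod 4 it follows that s + 1 is twice an odd number, so \<open>m\<close> is
  the 2-adic valuation of s - 1. The oddness of \<open>r\<close> later preserves a sign under the
  power \<open>r\<close>; the bound on \<open>m\<close> makes fourth roots of unity fixed by
  \<open>\<sigma>\<close>.\<close>

lemma two_part_square_minus_one:
  fixes s :: nat
  assumes s: "s mod 4 = 1" "s > 1"
  obtains m r where "multiplicity 2 (s * s - 1) = Suc m" "s = 1 + 2 ^ m * r" "odd r" "m \<ge> 2"
proof -
  define k where "k = s div 4"
  have k: "s = 4 * k + 1" using s(1) unfolding k_def by presburger
  define m where "m = multiplicity 2 (s - 1)"
  have "s - 1 \<noteq> 0" using s by simp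
  then obtain r where r: "s - 1 = 2 ^ m * r" "\<not> 2 dvd r"
    using multiplicity_decompose'[of "s - 1" 2] unfolding m_def by auto
  have "s * s - 1 = (s - 1) * (s + 1)" using k by (simp add: algebra_simps)
  moreover have "multiplicity 2 (s + 1) = 1"
  proof -
    have "s + 1 = 2 * (2 * k + 1)" using k by simp
    then have "multiplicity 2 (s + 1) = Suc (multiplicity 2 (2 * k + 1))"
      by (simp only:) (rule multiplicity_times_same, auto)
    also have "multiplicity 2 (2 * k + 1) = 0" by (rule not_dvd_imp_multiplicity_0) simp
    finally show ?thesis by simp
  qed
  moreover have "multiplicity 2 ((s - 1) * (s + 1)) = m + multiplicity 2 (s + 1)"
    unfolding m_def using s by (intro prime_elem_multiplicity_mult_distrib) auto
  ultimately have 1: "multiplicity 2 (s * s - 1) = Suc m" by simp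
  have "2 ^ 2 dvd s - 1" using k by simp
  then have "m \<ge> 2" unfolding m_def using s by (intro multiplicity_geI) auto
  moreover have "s = 1 + 2 ^ m * r" using r(1) s by linarith
  ultimately show ?thesis using that[OF 1] r(2) by blast
qed

text \<open>Identifies the characteristic, so that raising to a power of \<open>q0\<close> is
  additive.\<close>

lemma CHAR_eq_prime:
  assumes "prime p" "CARD('k::{field,finite}) = p ^ N"
  shows "CHAR('k) = p"
proof -
  have "CHAR('k) > 0" by (rule finite_imp_CHAR_pos) simp
  then have pr: "prime CHAR('k)" by (rule prime_CHAR_semidom)
  moreover have "CHAR('k) dvd p ^ N" using CHAR_dvd_CARD[where ?'a = 'k] assms(2) by simp
  ultimately show ?thesis using assms(1) by (meson prime_dvd_power primes_dvd_imp_eq)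
qed

lemma map_matrix_mat2: "map_matrix f (mat2 a b c d) = mat2 (f a) (f b) (f c) (f d)"
  by (simp add: vec_eq_iff forall_2)

lemma map_matrix_auto:
  fixes f :: "'k::{field,finite} \<Rightarrow> 'k"
  assumes add: "\<And>x y. f (x + y) = f x + f y" and mult: "\<And>x y. f (x * y) = f x * f y"
    and one: "f 1 = 1" and inj: "inj f"
  shows "(\<lambda>A\<in>carrier SL2. map_matrix f A) \<in> auto SL2"
proof -
  let ?\<psi> = "\<lambda>A\<in>carrier SL2. map_matrix f A"
  have zero: "f 0 = 0" using add[of 0 0] by (metis add_0_right add_left_cancel)
  have neg: "f (- x) = - f x" for x
    using add[of x "- x"] zero by (simp add: eq_neg_iff_add_eq_0 add.commute)
  have diff: "f (x - y) = f x - f y" for x y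
    using add[of x "- y"] neg by simp
  have car: "map_matrix f A \<in> carrier SL2" if A: "A \<in> carrier SL2" for A
  proof -
    obtain a b c d where A': "A = mat2 a b c d" by (rule mat2_cases)
    have "f (a * d - b * c) = 1" using A one by (simp add: A')
    then show ?thesis by (simp add: A' map_matrix_mat2 diff mult)
  qed
  have "map_matrix f (A ** B) = map_matrix f A ** map_matrix f B" for A B :: "'k ^ 2 ^ 2"
    by (cases A rule: mat2_cases; cases B rule: mat2_cases) (simp add: map_matrix_mat2 add mult)
  moreover have "A ** B \<in> carrier SL2" if "A \<in> carrier SL2" "B \<in> carrier SL2" for A B :: "'k ^ 2 ^ 2"
    using that SL2.m_closed[of A B] by simp
  ultimately have "?\<psi> \<in> hom SL2 SL2"
    using car by (intro homI) auto
  moreover have "inj_on ?\<psi> (carrier SL2)"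
  proof (rule inj_onI)
    fix A B :: "'k ^ 2 ^ 2"
    assume "A \<in> carrier SL2" "B \<in> carrier SL2" "?\<psi> A = ?\<psi> B"
    then show "A = B"
      using inj by (cases A rule: mat2_cases; cases B rule: mat2_cases) (simp add: map_matrix_mat2 inj_def)
  qed
  moreover from this have "?\<psi> ` carrier SL2 = carrier SL2"
    using car by (intro endo_inj_surj) auto
  ultimately show ?thesis by (simp add: auto_def Bij_def bij_betw_def)
qed

text \<open>Compatibility with negation lets \<open>\<psi>\<close> carry pairs of opposite matrices
  to such pairs, and reflects equality of pairs back to the matrices.\<close>

lemma quot_aut_PSL2:
  fixes \<psi> :: "'k::{field,finite} ^ 2 ^ 2 \<Rightarrow> 'k ^ 2 ^ 2"
  assumes \<psi>: "\<psi> \<in> auto SL2" and neg: "\<And>A. A \<in> carrier SL2 \<Longrightarrow> \<psi> (- A) = - \<psi> A"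
  shows "A \<in> carrier SL2 \<Longrightarrow> quot_aut SL2 (center SL2) \<psi> (pm A) = pm (\<psi> A)"
    and "quot_aut SL2 (center SL2) \<psi> \<in> auto PSL2"
proof -
  let ?\<phi> = "quot_aut SL2 (center SL2) \<psi>"
  have hom: "\<psi> \<in> hom SL2 SL2" and bij: "bij_betw \<psi> (carrier SL2) (carrier SL2)"
    using \<psi> by (auto simp: auto_def Bij_def)
  have car: "\<psi> A \<in> carrier SL2" if "A \<in> carrier SL2" for A
    using hom that by (auto simp: hom_def)
  have mult: "\<psi> (A ** B) = \<psi> A ** \<psi> B" if "A \<in> carrier SL2" "B \<in> carrier SL2" for A B
    using hom_mult[OF hom that] by simp
  have closed: "A ** B \<in> carrier SL2" if "A \<in> carrier SL2" "B \<in> carrier SL2" for A B :: "'k ^ 2 ^ 2"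
    using that SL2.m_closed[of A B] by simp
  show eq: "?\<phi> (pm A) = pm (\<psi> A)" if "A \<in> carrier SL2" for A
    using that neg[OF that] by (simp add: quot_aut_def) (simp add: pm_def)
  have "?\<phi> \<in> hom PSL2 PSL2"
    using car closed by (intro homI) (auto simp: carrier_PSL2 pm_mult eq mult)
  moreover have "inj_on ?\<phi> (carrier PSL2)"
  proof (rule inj_onI)
    fix X Y assume "X \<in> carrier PSL2" "Y \<in> carrier PSL2" and e: "?\<phi> X = ?\<phi> Y"
    then obtain A B where AB: "A \<in> carrier SL2" "X = pm A" "B \<in> carrier SL2" "Y = pm B"
      by (auto simp: carrier_PSL2)
    then have "\<psi> A = \<psi> B \<or> \<psi> A = \<psi> (- B)" using e by (simp add: eq pm_eq_iff neg)
    moreover have "- B \<in> carrier SL2" using AB by simp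
    ultimately have "A = B \<or> A = - B"
      using inj_onD[OF bij_betw_imp_inj_on[OF bij]] AB by metis
    then show "X = Y" using AB by (simp add: pm_eq_iff)
  qed
  moreover from this have "?\<phi> ` carrier PSL2 = carrier PSL2"
    using car by (intro endo_inj_surj) (auto simp: carrier_PSL2 eq)
  moreover have "?\<phi> \<in> extensional (carrier PSL2)" by (simp add: quot_aut_def)
  ultimately show "?\<phi> \<in> auto PSL2" by (simp add: auto_def Bij_def bij_betw_def)
qed

\<comment> \<open>keep the group operation of \<open>PSL2\<close> from unfolding to products of sets of matrices\<close>
declare one_FactGroup [simp del] mult_FactGroup [simp del]


lemma PSL2_conj:
  assumes "A \<in> carrier SL2" "B \<in> carrier SL2" "B' \<in> carrier SL2" and eq: "A ** B = B' ** A"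
  shows "pm A \<otimes>\<^bsub>PSL2\<^esub> pm B \<otimes>\<^bsub>PSL2\<^esub> inv\<^bsub>PSL2\<^esub> (pm A) = pm B'"
proof -
  have "pm A \<otimes>\<^bsub>PSL2\<^esub> pm B = pm B' \<otimes>\<^bsub>PSL2\<^esub> pm A" by (simp only: PSL2_mult eq)
  then show ?thesis
    using assms(1-3) by (metis PSL2.inv_solve_right' PSL2.m_closed pm_carrier)
qed

section \<open>Action of the elements \<open>rot u\<close> on four-groups modulo the center\<close>

context
  fixes i h :: "'a::field"
  assumes i: "i * i = - 1" and h: "h + h = 1"
begin

lemma quat_elements:
  assumes u: "u \<noteq> 0" and X: "X \<in> pm ` quat i u"
  obtains "X = pm (dg 1)" | "X = pm (dg i)" | "X = pm (ad u)" | "X = pm (ad (i * u))"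
  using X unfolding pm_quat[OF i h] by blast

text \<open>\<open>rot u\<close> permutes the three nontrivial elements of the four-group
  cyclically. Its class is therefore an arrow from the four-group to itself, to which
  \<open>link_Inn_conj\<close> applies.\<close>

lemma rot_transporter:
  assumes u: "u \<noteq> 0"
  shows "pm (rot i h u) \<in> transporter PSL2 (pm ` quat i u) (pm ` quat i u)"
proof -
  note i0 = i_nonzero[OF i h]
  have r: "rot i h u \<in> carrier SL2" using rot_SL2[OF i h u] .
  have "pm (rot i h u) \<otimes>\<^bsub>PSL2\<^esub> X \<otimes>\<^bsub>PSL2\<^esub> inv\<^bsub>PSL2\<^esub> pm (rot i h u) \<in> pm ` quat i u"
    if X: "X \<in> pm ` quat i u" for X
    using u X
  proof (cases rule: quat_elements)
    case 1
    have "rot i h u ** dg 1 = dg 1 ** rot i h u" by (simp add: dg_def rot_def[OF i h])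
    from PSL2_conj[OF r _ _ this] show ?thesis using 1 by (simp add: pm_quat[OF i h] del: PSL2_mult)
  next
    case 2
    then show ?thesis using PSL2_conj[OF r _ _ rot_conj(1)[OF i h u]] u i0
      by (simp add: pm_quat[OF i h])
  next
    case 3
    then show ?thesis using PSL2_conj[OF r _ _ rot_conj(2)[OF i h u]] u i0
      by (simp add: pm_quat[OF i h])
  next
    case 4
    then show ?thesis using PSL2_conj[OF r _ _ rot_conj(3)[OF i h u]] u i0
      by (simp add: pm_quat[OF i h])
  qed
  then show ?thesis using r by (auto simp: transporter_def conj_set_def)
qed

text \<open>A cyclic permutation of the three nontrivial elements fixes none of them, so only the
  identity of the four-group commutes with \<open>rot u\<close>.\<close>

lemma quat_commute_rot:
  assumes u: "u \<noteq> 0" and X: "X \<in> pm ` quat i u"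
    and comm: "X \<otimes>\<^bsub>PSL2\<^esub> pm (rot i h u) = pm (rot i h u) \<otimes>\<^bsub>PSL2\<^esub> X"
  shows "X = \<one>\<^bsub>PSL2\<^esub>"
proof -
  note i0 = i_nonzero[OF i h]
  have r: "rot i h u \<in> carrier SL2" using rot_SL2[OF i h u] .
  have i1: "i \<noteq> 1" "i \<noteq> - 1" using i neg_one_neq[OF i h] by auto
  have key: "B = B' \<or> B = - B'"
    if "X = pm B" "B \<in> carrier SL2" "B' \<in> carrier SL2" "rot i h u ** B = B' ** rot i h u" for B B'
  proof -
    have "pm B \<otimes>\<^bsub>PSL2\<^esub> pm (rot i h u) = pm B' \<otimes>\<^bsub>PSL2\<^esub> pm (rot i h u)"
      using comm that(1,4) by (simp only: PSL2_mult)
    then have "pm B = pm B'" using that(2,3) r by (simp only: PSL2.right_cancel pm_carrier)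
    then show ?thesis by (simp add: pm_eq_iff)
  qed
  show ?thesis using u X
  proof (cases rule: quat_elements)
    case 1
    then show ?thesis by (simp add: PSL2_one dg_def)
  next
    case 2
    from key[OF 2 _ _ rot_conj(1)[OF i h u]] show ?thesis using u i0 by (simp add: dg_ad_uminus)
  next
    case 3
    from key[OF 3 _ _ rot_conj(2)[OF i h u]] have "1 * u = i * u \<or> 1 * u = (- i) * u"
      using u i0 by (simp add: dg_ad_uminus)
    then have "1 = i \<or> 1 = - i" by (simp only: mult_right_cancel[OF u])
    then show ?thesis using i1 by (metis minus_minus)
  next
    case 4
    from key[OF 4 _ _ rot_conj(3)[OF i h u]] show ?thesis using u i0 by (simp add: dg_ad_uminus)
  qed
qed

text \<open>Replacing \<open>u\<close> by its negative flips the off-diagonal entries and keeps the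
  diagonal ones. The nonzero upper-right entry excludes equality of the matrices, the nonzero
  upper-left entry excludes equality up to sign.\<close>

lemma pm_rot_uminus_neq:
  assumes u: "u \<noteq> 0"
  shows "pm (rot i h (- u)) \<noteq> pm (rot i h u)"
proof
  assume "pm (rot i h (- u)) = pm (rot i h u)"
  moreover have c: "h * (1 + i) \<noteq> 0" using one_plus_i[OF i h] h by auto
  moreover have "x \<noteq> - x" if "x \<noteq> 0" for x :: 'a
    using that two[OF i h] by (metis add.right_inverse mult_2 mult_eq_0_iff)
  moreover have "u * (h * (1 + i)) \<noteq> 0" using u c by simp
  ultimately show False by (metis mat2_eq_iff mat2_uminus minus_mult_left pm_eq_iff rot_def[OF i h])
qed

end

lemma rigid_noninner_field_automorphism:
  fixes S :: "('k::{field,finite} ^ 2 ^ 2) set" and q0 l q :: nat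
  assumes q0: "prime q0" "q0 mod 4 = 1" and l: "l \<ge> 1" and q: "q = q0 ^ (2 ^ l)"
    and card: "CARD('k) = q"
    and S: "S \<in> Syl2 (SL2\<lparr>carrier := normalizer SL2 SL2_diag\<rparr>)"
  shows "\<exists>\<alpha> \<in> carrier (link_Aut PSL2 (pm ` S)). rigid PSL2 (pm ` S) \<alpha> \<and> \<alpha> \<notin> link_Inn PSL2 (pm ` S) \<and>
           (\<exists>\<psi> \<in> SL2_field_auts q0. induced_by SL2 (pm ` S) \<psi> \<alpha>)"
proof -
  \<comment> \<open>The exponent that makes \<open>s\<close> the square root of \<open>q\<close>;
    the subtraction is genuine because \<open>l \<ge> 1\<close>.\<close>
  define a where "a = (2::nat) ^ (l - 1)"
  define s where "s = q0 ^ a"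
  have a1: "a \<ge> 1" by (simp add: a_def)
  have ss: "q = s * s"
    unfolding q s_def a_def using l by (simp add: power_add[symmetric] mult_2[symmetric] power_Suc[symmetric] del: power_Suc)
  have s4: "s mod 4 = 1" unfolding s_def using power_mod[of q0 4 a] q0(2) by simp
  have s1: "s > 1" unfolding s_def using one_less_power[OF prime_gt_1_nat[OF q0(1)], of a] a1 by simp
  obtain m r where mr: "multiplicity 2 (s * s - 1) = Suc m" "s = 1 + 2 ^ m * r" "odd r" "m \<ge> 2"
    using two_part_square_minus_one[OF s4 s1] .
  have s_odd: "odd s" using mr(2,4) by simp
  have char: "CHAR('k) = q0" using CHAR_eq_prime[OF q0(1)] card q by blast
  define \<sigma> where "\<sigma> = (\<lambda>u::'k. u ^ s)"
  have \<sigma>_add: "\<sigma> (x + y) = \<sigma> x + \<sigma> y" for x y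
    unfolding \<sigma>_def s_def using q0(1) char by (intro freshmans_dream'[where n = a]) auto
  have \<sigma>_mult: "\<sigma> (x * y) = \<sigma> x * \<sigma> y" for x y by (simp add: \<sigma>_def power_mult_distrib)
  have \<sigma>_one: "\<sigma> 1 = 1" by (simp add: \<sigma>_def)
  have \<sigma>_uminus: "\<sigma> (- x) = - \<sigma> x" for x using s_odd by (simp add: \<sigma>_def)
  have \<sigma>_zero: "\<sigma> 0 = 0" using s1 by (simp add: \<sigma>_def)
  have \<sigma>_inverse: "\<sigma> (inverse x) = inverse (\<sigma> x)" for x by (simp add: \<sigma>_def power_inverse)
  have \<sigma>_0_iff: "\<sigma> x = 0 \<longleftrightarrow> x = 0" for x using s1 by (simp add: \<sigma>_def)
  have \<sigma>_inj: "inj \<sigma>"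
  proof (rule injI)
    fix x y assume "\<sigma> x = \<sigma> y"
    then have "\<sigma> (x - y) = 0" using \<sigma>_add[of x "- y"] by (simp add: \<sigma>_uminus)
    then show "x = y" by (simp add: \<sigma>_0_iff)
  qed
  have two: "(2::'k) \<noteq> 0"
  proof
    assume "(2::'k) = 0"
    then have "CHAR('k) dvd 2" using of_nat_eq_0_iff_char_dvd[where ?'a = 'k, of 2] by simp
    then have "q0 = 2" using char q0(1) by (metis primes_dvd_imp_eq two_is_prime_nat)
    then show False using q0(2) by simp
  qed
  define h where "h = inverse (2::'k)"
  have hh: "h + h = 1" using two by (metis h_def mult_2 right_inverse)

  define \<psi> where "\<psi> = (\<lambda>A\<in>carrier SL2. map_matrix (\<lambda>u::'k. u ^ (q0 ^ a)) A)"
  have \<psi>_field: "\<psi> \<in> SL2_field_auts q0" unfolding SL2_field_auts_def \<psi>_def using a1 by blast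
  have \<psi>_eq: "\<psi> = (\<lambda>A\<in>carrier SL2. map_matrix \<sigma> A)" by (simp add: \<psi>_def \<sigma>_def s_def)
  have \<psi>_auto: "\<psi> \<in> auto SL2"
    unfolding \<psi>_eq by (rule map_matrix_auto[OF \<sigma>_add \<sigma>_mult \<sigma>_one \<sigma>_inj])
  have \<psi>_mat2: "\<psi> (mat2 w x y z) = mat2 (\<sigma> w) (\<sigma> x) (\<sigma> y) (\<sigma> z)" if "w * z - x * y = 1" for w x y z
    using that by (simp add: \<psi>_eq map_matrix_mat2)
  have \<psi>_neg: "\<psi> (- A) = - \<psi> A" if "A \<in> carrier SL2" for A
    using that by (cases A rule: mat2_cases) (simp add: \<psi>_mat2 \<sigma>_uminus)
  define \<psi>' where "\<psi>' = quot_aut SL2 (center SL2) \<psi>"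
  have \<psi>'_auto: "\<psi>' \<in> auto PSL2" and \<psi>'_pm: "\<And>A. A \<in> carrier SL2 \<Longrightarrow> \<psi>' (pm A) = pm (\<psi> A)"
    unfolding \<psi>'_def using quot_aut_PSL2[OF \<psi>_auto \<psi>_neg] by blast+

  have n: "multiplicity 2 (CARD('k) - 1) = Suc m" using mr(1) card ss by simp
  have q3: "CARD('k) > 3"
  proof -
    have "s \<ge> 5" using s4 s1 by presburger
    then have "5 * 5 \<le> s * s" by (rule mult_mono) (use \<open>s \<ge> 5\<close> in auto)
    then show ?thesis using card ss by simp
  qed
  have qodd: "odd CARD('k)" using s_odd card ss by simp
  obtain D e where D: "S = monomial D e" "card D = 2 ^ Suc m" "e \<noteq> 0" "0 \<notin> D" "1 \<in> D"
    "\<And>x y. x \<in> D \<Longrightarrow> y \<in> D \<Longrightarrow> x * y \<in> D" "\<And>x. x \<in> D \<Longrightarrow> inverse x \<in> D"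
    "\<And>x. x \<in> D \<Longrightarrow> x ^ (2 ^ Suc m) = 1" "subgroup S SL2"
    using sylow_normalizer_diag[OF S n[symmetric] q3 qodd] by blast
  obtain \<zeta> where \<zeta>: "\<zeta> \<in> D" "\<zeta> ^ (2 ^ m) = - 1"
    using order_two_power_element[OF _ D(2,8)] by auto
  have Dpow: "x ^ k \<in> D" if "x \<in> D" for x and k :: nat
    by (induction k) (use D(5,6) that in auto)
  have Dm1: "- 1 \<in> D" using Dpow[OF \<zeta>(1), of "2 ^ m"] \<zeta>(2) by simp
  have Dneg: "- x \<in> D" if "x \<in> D" for x using D(6)[OF Dm1 that] by simp
  \<comment> \<open>Its square is \<open>\<zeta> ^ (2 ^ m)\<close>, which is -1.\<close>
  define i where "i = \<zeta> ^ (2 ^ (m - 1))"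
  have iD: "i \<in> D" unfolding i_def by (rule Dpow[OF \<zeta>(1)])
  have ii: "i * i = - 1"
  proof -
    have "(2::nat) ^ (m - 1) + 2 ^ (m - 1) = 2 ^ m" using mr(4) by (cases m) auto
    then show ?thesis unfolding i_def \<zeta>(2)[symmetric] by (simp only: power_add[symmetric])
  qed
  have \<sigma>_split: "\<sigma> x = x * (x ^ (2 ^ m)) ^ r" for x
    by (simp add: \<sigma>_def mr(2) power_mult)
  have \<sigma>_D: "\<sigma> x = x \<or> \<sigma> x = - x" if x: "x \<in> D" for x
  proof -
    have "x ^ (2 ^ m) * x ^ (2 ^ m) = 1"
      using D(8)[OF x] by (simp add: power_add[symmetric] mult_2[symmetric])
    then have "x ^ (2 ^ m) = 1 \<or> x ^ (2 ^ m) = - 1" by (simp add: square_eq_1_iff)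
    then show ?thesis using mr(3) by (auto simp: \<sigma>_split)
  qed
  have \<sigma>_\<zeta>: "\<sigma> \<zeta> = - \<zeta>" using mr(3) by (simp add: \<sigma>_split \<zeta>(2))
  \<comment> \<open>\<open>i\<close> has to be fixed exactly, not merely up to sign, since
    \<open>rot\<close> contains 1 + i. It is fixed because its order 4 divides 2^m.\<close>
  have \<sigma>_i: "\<sigma> i = i"
  proof -
    have "i ^ 4 = (i * i) * (i * i)" by (simp add: power4_eq_xxxx mult.assoc)
    then have "i ^ 4 = 1" by (simp add: ii)
    moreover have "(2::nat) ^ m = 4 * 2 ^ (m - 2)"
    proof -
      have "(2::nat) ^ (2 + (m - 2)) = 4 * 2 ^ (m - 2)" by (simp add: power_add)
      moreover have "2 + (m - 2) = m" using mr(4) by linarith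
      ultimately show ?thesis by metis
    qed
    ultimately have "i ^ (2 ^ m) = 1" by (simp add: power_mult)
    then show ?thesis by (simp add: \<sigma>_split)
  qed
  have \<sigma>_h: "\<sigma> h = h"
  proof -
    have "\<sigma> h + \<sigma> h = 1" using \<sigma>_add[of h h] by (simp add: hh \<sigma>_one)
    then have "2 * \<sigma> h = 2 * h" by (simp only: mult_2 hh)
    then show ?thesis by (simp only: mult_left_cancel[OF two])
  qed
  \<comment> \<open>conjugation by \<open>dg t\<close> undoes the effect of \<open>\<sigma>\<close> on the element \<open>ad e\<close> of \<open>S\<close>\<close>
  define t where "t = inverse e ^ (2 ^ (m - 1) * r)"
  have t0: "t \<noteq> 0" using D(3) by (simp add: t_def)
  \<comment> \<open>The exponent of \<open>t\<close> is half of s - 1 = \<open>2 ^ m * r\<close>, so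
    \<open>t * t\<close> is e^(1-s).\<close>
  have tt: "t * t * \<sigma> e = e"
  proof -
    have "2 ^ (m - 1) * r + 2 ^ (m - 1) * r = 2 ^ m * r" using mr(4) by (cases m) auto
    then have "t * t = inverse e ^ (2 ^ m * r)" unfolding t_def by (simp only: power_add[symmetric])
    then show ?thesis using D(3) by (simp add: \<sigma>_def mr(2) power_add power_inverse)
  qed

  define R where "R = pm ` S"
  have quatS: "quat i (d * e) \<subseteq> S" if d: "d \<in> D" for d
  proof -
    have Q: "{1, - 1, i, - i} \<subseteq> D" using D(5) Dm1 iD Dneg by simp
    have "ad (x * (d * e)) \<in> (\<lambda>d. ad (d * e)) ` D" if "x \<in> {1, - 1, i, - i}" for x
    proof -
      have "x * d \<in> D" using that Q D(6)[OF _ d] by blast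
      then show ?thesis by (rule rev_image_eqI) (simp add: mult.assoc)
    qed
    then show ?thesis
      unfolding quat_def[OF ii hh] D(1) monomial_def using Q by blast
  qed
  have V_sub: "subgroup (pm ` quat i u) PSL2" if "u \<noteq> 0" for u
    using group_hom.subgroup_img_is_subgroup[OF pm_hom quat_subgroup[OF ii hh that]] .
  have fin: "finite (carrier (PSL2 :: ('k ^ 2 ^ 2) set monoid))" by simp
  have V: "two_centric PSL2 (pm ` quat i u)" "cent_core PSL2 (pm ` quat i u) = {\<one>\<^bsub>PSL2\<^esub>}" if u: "u \<noteq> 0" for u
    using PSL2.self_centralizing_two_group[OF fin V_sub[OF u] card_pm_quat[OF ii hh u] centralizer_quat[OF ii hh u]]
    by blast+
  have R_sub: "subgroup R PSL2"
    unfolding R_def using group_hom.subgroup_img_is_subgroup[OF pm_hom D(9)] .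
  have card_R: "card R = 2 ^ Suc m"
    unfolding R_def D(1) using card_pm_monomial[of D e] D(2,3,4) Dneg two by simp
  have VeR: "pm ` quat i e \<subseteq> R" using quatS[OF D(5)] by (auto simp: R_def)
  \<comment> \<open>\<open>R\<close> contains a self-centralizing four-group, so \<open>R\<close> is
    self-centralizing as well and hence 2-centric.\<close>
  have "centralizer PSL2 R \<subseteq> centralizer PSL2 (pm ` quat i e)"
    using VeR by (auto simp: centralizer_def)
  then have cent_R: "centralizer PSL2 R \<subseteq> R"
    using centralizer_quat[OF ii hh D(3)] VeR by blast
  interpret linking PSL2 R
    by (intro linking.intro linking_axioms.intro PSL2.is_group fin R_sub
        PSL2.self_centralizing_two_group(1)[OF fin R_sub card_R cent_R])

  \<comment> \<open>Written as an inner automorphism after \<open>\<psi>'\<close>, the form in which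
    \<open>kappa_eq\<close> accepts a representative of the outer class.\<close>
  define \<phi> where "\<phi> = compose (carrier PSL2) (inn (pm (dg t))) \<psi>'"
  have t_car: "pm (dg t) \<in> carrier PSL2" using t0 by simp
  have \<psi>_car: "\<psi> A \<in> carrier SL2" if "A \<in> carrier SL2" for A
    using \<psi>_auto that by (auto simp: auto_def hom_def)
  have \<phi>_pm: "\<phi> (pm A) = pm (dg t ** \<psi> A ** dg (inverse t))" if A: "A \<in> carrier SL2" for A
    using A t0 \<psi>_car[OF A]
    by (simp add: \<phi>_def compose_def inn_def \<psi>'_pm PSL2_inv dg_ad_inv)
  have \<phi>_mat2: "\<phi> (pm (mat2 w x y z)) = pm (mat2 (\<sigma> w) (t * t * \<sigma> x) (inverse (t * t) * \<sigma> y) (\<sigma> z))"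
    if "w * z - x * y = 1" for w x y z
    using that t0 by (simp add: \<phi>_pm \<psi>_mat2 dg_def field_simps)
  have \<phi>_dg: "\<phi> (pm (dg u)) = pm (dg (\<sigma> u))" if "u \<noteq> 0" for u
    using that by (simp add: dg_def \<phi>_mat2 \<sigma>_zero \<sigma>_inverse)
  have \<phi>_ad: "\<phi> (pm (ad u)) = pm (ad (t * t * \<sigma> u))" if "u \<noteq> 0" for u
    using that t0 by (simp add: ad_def \<phi>_mat2 \<sigma>_zero \<sigma>_inverse \<sigma>_uminus)
  \<comment> \<open>Because \<open>\<sigma>\<close> fixes \<open>i\<close> and \<open>h\<close>,
    only the parameter of \<open>rot\<close> is affected, and in the same way as that of
    \<open>ad\<close>.\<close>
  have \<phi>_rot: "\<phi> (pm (rot i h u)) = pm (rot i h (t * t * \<sigma> u))" if u: "u \<noteq> 0" for u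
  proof -
    have "h * (1 + i) * (h * (1 - i)) - u * (h * (1 + i)) * (- (h * (1 - i) * inverse u)) = 1"
      using rot_SL2[OF ii hh u] by (simp only: rot_def[OF ii hh] mat2_SL2)
    from \<phi>_mat2[OF this] show ?thesis
      using t0 \<sigma>_add[of 1 "- i"]
      by (simp add: rot_def[OF ii hh] \<sigma>_mult \<sigma>_add \<sigma>_one \<sigma>_uminus \<sigma>_i \<sigma>_h \<sigma>_inverse mult.assoc mult.left_commute mult.commute)
  qed
  \<comment> \<open>After the correction by \<open>t\<close>, each parameter changes at most by a
    sign, which \<open>pm\<close> forgets.\<close>
  have \<phi>_fix: "\<phi> X = X" if "X \<in> R" for X
  proof -
    obtain A where A: "A \<in> S" "X = pm A" using \<open>X \<in> R\<close> by (auto simp: R_def)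
    consider d where "d \<in> D" "A = dg d" | d where "d \<in> D" "A = ad (d * e)"
      using A D(1) unfolding monomial_def by blast
    then show ?thesis
    proof cases
      case 1
      then have "d \<noteq> 0" using D(4) by auto
      then show ?thesis using \<sigma>_D[OF 1(1)] by (auto simp: A(2) 1(2) \<phi>_dg pm_eq_iff dg_ad_uminus)
    next
      case 2
      then have d: "d \<noteq> 0" using D(4) by auto
      have "t * t * \<sigma> (d * e) = \<sigma> d * e"
        using tt by (simp add: \<sigma>_mult mult.left_commute)
      then show ?thesis
        using \<sigma>_D[OF 2(1)] d D(3) by (auto simp: A(2) 2(2) \<phi>_ad pm_eq_iff dg_ad_uminus)
    qed
  qed
  then have \<phi>R: "\<phi> ` R = R" by auto
  note kap = kappa_eq[OF \<psi>'_auto t_car \<phi>_def \<phi>R]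
  let ?\<alpha> = "link_of_aut PSL2 R \<phi>"
  have "?\<alpha> \<in> carrier (link_Aut PSL2 R)"
    using link_of_aut_link_aut[OF kap(1) \<phi>R] by (simp add: link_Aut_def)
  moreover have "rigid PSL2 R ?\<alpha>" using rigid_link_of_aut[OF kap(1)] \<phi>_fix by blast
  moreover have "induced_by SL2 R \<psi> ?\<alpha>"
    unfolding induced_by_def Let_def using kap(2) by (simp add: \<psi>'_def)
  moreover have "?\<alpha> \<notin> link_Inn PSL2 R"
  proof
    assume "?\<alpha> \<in> link_Inn PSL2 R"
    then obtain g where g: "g \<in> carrier PSL2"
      "\<And>P x. P \<in> Obj L \<Longrightarrow> core P = {\<one>\<^bsub>PSL2\<^esub>} \<Longrightarrow> x \<in> transporter PSL2 P P \<Longrightarrow>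
         \<phi> x = g \<otimes>\<^bsub>PSL2\<^esub> x \<otimes>\<^bsub>PSL2\<^esub> inv\<^bsub>PSL2\<^esub> g"
      using link_Inn_conj[OF kap(1) \<phi>R] by blast
    \<comment> \<open>The two instances that matter are \<open>d\<close> = 1 and \<open>d\<close> =
      \<open>\<zeta>\<close>: \<open>\<sigma>\<close> fixes the first and negates the
      second.\<close>
    have V_Obj: "pm ` quat i (d * e) \<in> Obj L" if d: "d \<in> D" for d
    proof -
      have "d * e \<noteq> 0" using d D(3,4) by auto
      moreover have "pm ` quat i (d * e) \<subseteq> R" using quatS[OF d] by (auto simp: R_def)
      ultimately show ?thesis using V_sub V(1) by (simp add: Obj_iff)
    qed
    have \<phi>g: "\<phi> x = g \<otimes>\<^bsub>PSL2\<^esub> x \<otimes>\<^bsub>PSL2\<^esub> inv\<^bsub>PSL2\<^esub> g"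
      if "d \<in> D" "x \<in> transporter PSL2 (pm ` quat i (d * e)) (pm ` quat i (d * e))" for d x
    proof -
      have "d * e \<noteq> 0" using that(1) D(3,4) by auto
      then show ?thesis using g(2)[OF V_Obj[OF that(1)] V(2) that(2)] by simp
    qed
    have comm: "g \<otimes>\<^bsub>PSL2\<^esub> x = x \<otimes>\<^bsub>PSL2\<^esub> g"
      if x: "x \<in> transporter PSL2 (pm ` quat i e) (pm ` quat i e)" "\<phi> x = x" for x
    proof -
      have xc: "x \<in> carrier PSL2" using x by (simp add: transporter_def)
      have "x = g \<otimes>\<^bsub>PSL2\<^esub> x \<otimes>\<^bsub>PSL2\<^esub> inv\<^bsub>PSL2\<^esub> g" using \<phi>g[OF D(5), of x] x by simp
      then have "x \<otimes>\<^bsub>PSL2\<^esub> g = g \<otimes>\<^bsub>PSL2\<^esub> x \<otimes>\<^bsub>PSL2\<^esub> inv\<^bsub>PSL2\<^esub> g \<otimes>\<^bsub>PSL2\<^esub> g" by simp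
      then show ?thesis using xc g(1) by (simp add: PSL2.m_assoc)
    qed
    \<comment> \<open>Elements of the four-group are themselves arrows from it to itself, and
      \<open>\<phi>\<close> fixes them because they lie in \<open>R\<close>.\<close>
    have "g \<otimes>\<^bsub>PSL2\<^esub> x = x \<otimes>\<^bsub>PSL2\<^esub> g" if "x \<in> pm ` quat i e" for x
      using comm[of x] transporter_self[OF V_Obj[OF D(5)], of x] \<phi>_fix[of x] VeR that by auto
    then have "g \<in> centralizer PSL2 (pm ` quat i e)" using g(1) by (simp add: centralizer_def)
    then have gV: "g \<in> pm ` quat i e" using centralizer_quat[OF ii hh D(3)] by blast
    have "\<phi> (pm (rot i h e)) = pm (rot i h e)" using \<phi>_rot[OF D(3)] tt by simp
    then have "g = \<one>\<^bsub>PSL2\<^esub>"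
      using quat_commute_rot[OF ii hh D(3) gV] comm rot_transporter[OF ii hh D(3)] by blast
    have \<zeta>e: "\<zeta> * e \<noteq> 0" using \<zeta>(1) D(3,4) by auto
    \<comment> \<open>On the second four-group the sign of \<open>\<sigma>\<close> on
      \<open>\<zeta>\<close> survives as the sign of the parameter of \<open>rot\<close>.
      Conjugation by \<open>g\<close>, by now the identity, would have to produce this
      change.\<close>
    have "t * t * \<sigma> (\<zeta> * e) = - (\<zeta> * e)"
      using tt by (simp add: \<sigma>_mult \<sigma>_\<zeta> mult.left_commute)
    then have "\<phi> (pm (rot i h (\<zeta> * e))) = pm (rot i h (- (\<zeta> * e)))"
      using \<phi>_rot[OF \<zeta>e] by simp
    moreover have "\<phi> (pm (rot i h (\<zeta> * e))) = pm (rot i h (\<zeta> * e))"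
      using \<phi>g[OF \<zeta>(1) rot_transporter[OF ii hh \<zeta>e]] \<open>g = \<one>\<^bsub>PSL2\<^esub>\<close> rot_SL2[OF ii hh \<zeta>e]
      by (simp del: PSL2_mult)
    ultimately show False using pm_rot_uminus_neq[OF ii hh \<zeta>e] by simp
  qed
  ultimately show ?thesis unfolding R_def using \<psi>_field by blast
qed

text \<open>The condition \<open>l \<ge> 1\<close> excludes the prime field: for \<open>l\<close> =
  0 every field automorphism is the identity, and any automorphism of the linking system that it
  induces is inner.\<close>

theorem theorem5p15:
  fixes G :: "('k::{field,finite} ^ 2 ^ 2) monoid"
    and T S :: "('k ^ 2 ^ 2) set"
    and H :: "('k ^ 2 ^ 2) set monoid"
    and R :: "('k ^ 2 ^ 2) set set"
    and q0 l q :: nat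
  assumes "prime q0" and "q0 mod 4 = 1"
    and "l \<ge> 1" and "q = q0 ^ (2 ^ l)" and "q mod 8 = 1"
    and "CARD('k) = q"
    and "G = SL2" and "T = SL2_diag"
    and "S \<in> Syl2 (G\<lparr>carrier := normalizer G T\<rparr>)"
    and "H = G Mod center G"
    and "R = (\<lambda>s. center G #>\<^bsub>G\<^esub> s) ` S"
  shows "\<exists>\<alpha> \<in> carrier (link_Aut H R). rigid H R \<alpha> \<and> \<alpha> \<notin> link_Inn H R \<and>
           (\<exists>\<psi> \<in> SL2_field_auts q0. induced_by G R \<psi> \<alpha>)"
proof -
  have "R = pm ` S" using assms(7,11) by (simp add: center_coset)
  then show ?thesis using rigid_noninner_field_automorphism[OF assms(1-4,6)] assms(7-10) by simp
qed

end
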